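(* Let $0 < c_1 < c_2 < \infty$, let $p = \gamma(0) \in \mathbb{R}^2$, and let $\mathbf{v} = (\mathbf{v}_1,\mathbf{v}_2):\mathbb{R}^2 \rightarrow \mathbb{R}^2$ be a vector field that is smooth and incompressible (i.e. $\frac{\partial \mathbf{v}_1}{\partial x} + \frac{\partial \mathbf{v}_2}{\partial y} = 0$) in a neighborhood of the disk of radius $1$ around $p$ and satisfies $c_1 < \|\mathbf{v}\| < c_2$. Let $\mathbf{v}^{\perp} = (-\mathbf{v}_2, \mathbf{v}_1)$. Then there exist $s,t \geq 0$ such that $$\left\| (e^{t \mathbf{v}} \circ e^{s \mathbf{v}^{\perp}})p - p\right\| = 1$$ and $$ |e^{t \mathbf{v}} \circ e^{s \mathbf{v}^{\perp}}p| \leq \sqrt{4\pi} \sqrt{ \frac{c_2}{c_1} }.$$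
   Context: $\|\cdot\|$ is the Euclidean norm on $\mathbb{R}^2$. For a vector field $\mathbf{w}$, $e^{t\mathbf{w}}x$ denotes the flow induced by $\mathbf{w}$: the value at time $t$ of the solution of $\dot\gamma(t) = \mathbf{w}(\gamma(t))$, $\gamma(0) = x$ (the flow lines in the claim being integral curves in the region where $\mathbf{v}$ is smooth). The notation $|e^{t \mathbf{v}}\circ e^{s \mathbf{v}^{\perp}} p|$ denotes not the norm of a point but the length of the curve in $\mathbb{R}^2$ obtained by first flowing along $\mathbf{v}^{\perp}$ from $p$ for time $s$ and then along $\mathbf{v}$ for time $t$: $$ |e^{t \mathbf{v}}\circ e^{s \mathbf{v}^{\perp}} p| := \int_{0}^{s}{\left\| \frac{\partial}{\partial u}e^{u \mathbf{v}^{\perp}} p\right\| du} + \int_{0}^{t}{ \left\| \frac{\partial}{\partial u}e^{u \mathbf{v}} \left( e^{s \mathbf{v}^{\perp}} p \right)\right\| du}.$$ *)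

theory Defs
  imports "HOL-Analysis.Analysis"
begin

text \<open>Class \<open>C\<^sup>n\<close> for a map on an open set \<open>S\<close>; only meant for open \<open>S\<close>, since the
  derivatives are unrestricted Frechet derivatives.\<close>

fun Cn_on :: "nat \<Rightarrow> 'a::real_normed_vector set \<Rightarrow> ('a \<Rightarrow> 'b::real_normed_vector) \<Rightarrow> bool" where
  "Cn_on 0 S f \<longleftrightarrow> continuous_on S f"
| "Cn_on (Suc n) S f \<longleftrightarrow>
     (\<forall>x\<in>S. f differentiable (at x)) \<and>
     (\<forall>h. Cn_on n S (\<lambda>x. frechet_derivative f (at x) h))"

definition smooth_on :: "'a::real_normed_vector set \<Rightarrow> ('a \<Rightarrow> 'b::real_normed_vector) \<Rightarrow> bool" where
  "smooth_on S f \<longleftrightarrow> (\<forall>n. Cn_on n S f)"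

definition partial_deriv :: "'n::finite \<Rightarrow> (real ^ 'n \<Rightarrow> real) \<Rightarrow> real ^ 'n \<Rightarrow> real" where
  "partial_deriv i f x = deriv (\<lambda>h. f (x + h *\<^sub>R axis i 1)) 0"

definition incompressible_on :: "(real ^ 2) set \<Rightarrow> (real ^ 2 \<Rightarrow> real ^ 2) \<Rightarrow> bool" where
  "incompressible_on S v \<longleftrightarrow>
     (\<forall>x\<in>S. partial_deriv 1 (\<lambda>y. v y $ 1) x + partial_deriv 2 (\<lambda>y. v y $ 2) x = 0)"

definition perp_field :: "(real ^ 2 \<Rightarrow> real ^ 2) \<Rightarrow> real ^ 2 \<Rightarrow> real ^ 2" where
  "perp_field v x = vector [- (v x $ 2), v x $ 1]"

text \<open>\<open>closed_segment 0 t\<close> rather than \<open>{0..t}\<close> also covers negative times.\<close>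

definition integral_curve ::
  "'a::real_normed_vector set \<Rightarrow> ('a \<Rightarrow> 'a) \<Rightarrow> real \<Rightarrow> 'a \<Rightarrow> (real \<Rightarrow> 'a) \<Rightarrow> bool" where
  "integral_curve U w t x \<gamma> \<longleftrightarrow>
     \<gamma> 0 = x \<and>
     (\<forall>u\<in>closed_segment 0 t.
        \<gamma> u \<in> U \<and> (\<gamma> has_vector_derivative w (\<gamma> u)) (at u within closed_segment 0 t))"

definition flow_exists :: "'a::real_normed_vector set \<Rightarrow> ('a \<Rightarrow> 'a) \<Rightarrow> real \<Rightarrow> 'a \<Rightarrow> bool" where
  "flow_exists U w t x \<longleftrightarrow> (\<exists>\<gamma>. integral_curve U w t x \<gamma>)"

text \<open>The point \<open>e\<^bsup>t w\<^esup> x\<close>. It is meaningful when \<open>flow_exists U w t x\<close> holds and \<open>w\<close> is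
  locally Lipschitz on the open set \<open>U\<close>, so that integral curves in \<open>U\<close> are unique.\<close>

definition flow :: "'a::real_normed_vector set \<Rightarrow> ('a \<Rightarrow> 'a) \<Rightarrow> real \<Rightarrow> 'a \<Rightarrow> 'a" where
  "flow U w t x = (THE y. \<exists>\<gamma>. integral_curve U w t x \<gamma> \<and> \<gamma> t = y)"

text \<open>For \<open>t \<ge> 0\<close> only.\<close>

definition flow_length :: "'a::real_normed_vector set \<Rightarrow> ('a \<Rightarrow> 'a) \<Rightarrow> real \<Rightarrow> 'a \<Rightarrow> real" where
  "flow_length U w t x =
     integral {0..t} (\<lambda>u. norm (vector_derivative (\<lambda>r. flow U w r x) (at u within {0..t})))"

text \<open>\<open>w\<^sub>1\<close> is followed first, as in \<open>e\<^bsup>t w\<^sub>2\<^esup> \<circ> e\<^bsup>s w\<^sub>1\<^esup>\<close>.\<close>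

definition two_flow_length ::
  "'a::real_normed_vector set \<Rightarrow> ('a \<Rightarrow> 'a) \<Rightarrow> real \<Rightarrow> ('a \<Rightarrow> 'a) \<Rightarrow> real \<Rightarrow> 'a \<Rightarrow> real" where
  "two_flow_length U w\<^sub>2 t w\<^sub>1 s x =
     flow_length U w\<^sub>1 s x + flow_length U w\<^sub>2 t (flow U w\<^sub>1 s x)"

end

(* Follow v^perp from p until its length is A = sqrt(pi c2 / c1), or until it leaves the disc; from
   each point gamma(s) of this curve follow v for time A / c2, hence for length at most A. If no such
   trajectory reached the unit circle, then X(s,t) = e^{tv} gamma(s) would map a rectangle into the
   open disc. It is injective: the stream function of v is constant along v and strictly increasing
   along v^perp, and v has no closed orbit in the disc, since the stream function would have a
   critical point, that is a zero of v, inside such an orbit. As v is divergence free, the Jacobian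
   of X is |v(gamma(s))|^2 for all t, so the image has area greater than
   c1 * A * (A / c2) = pi, a contradiction.

   To have trajectories for all times, v is replaced by its composition with the nearest-point
   projection to the disc, which is globally Lipschitz; nothing changes until the exit time. *)
theory Submission imports Defs begin

section \<open>Existence and uniqueness of integral curves\<close>

text \<open>Suppose the first stretch may have length a and the second takes time b / c2, hence has
  length at most b. The swept area is the integral of |v(gamma s)|^2 over the rectangle; one factor
  |v| integrates to the length a and the other is at least c1, so the area is at least c1 a b / c2.
  Forcing an exit thus asks for a b = pi c2 / c1, and a + b is then least for a = b = A, which gives
  2 A = sqrt(4 pi) sqrt(c2 / c1).

  Two obstacles shape the proof. The change of variables needs the trajectories to be differentiable
  in both parameters, so the dependence of solutions on their initial value is studied, and the
  Jacobian is followed through the linearized equation. Moreover \<open>flow\<close> is a definite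
  description over all integral curves in \<open>U\<close>, which might leave the disc; uniqueness
  against them needs a Lipschitz bound on a ball slightly larger than the disc.\<close>

lemma gronwall_norm:
  fixes z g :: "real \<Rightarrow> 'a::euclidean_space"
  assumes der: "\<And>t. t \<in> {0..T} \<Longrightarrow> (z has_vector_derivative g t) (at t within {0..T})"
    and bnd: "\<And>t. t \<in> {0..T} \<Longrightarrow> norm (g t) \<le> L * norm (z t) + e"
    and "0 \<le> L" "0 \<le> e" and t: "t \<in> {0..T}"
  shows "norm (z t) \<le> exp ((L + 1) * T) * (norm (z 0) + e)"
proof -
  \<comment> \<open>The squared norm is used because the norm is not differentiable at 0. Since 2 e
    |z| \<le> e^2 + |z|^2, the derivative of |z|^2 is at most K |z|^2 + e^2, so adding e^2 makes the
    weighted quantity \<open>f\<close> nonincreasing.\<close>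
  define K where "K = 2 * L + 1"
  define f where "f = (\<lambda>u. exp (- K * u) * (z u \<bullet> z u + e\<^sup>2))"
  have cz: "continuous_on {0..T} z"
    using der by (meson continuous_on_vector_derivative)
  have "f t \<le> f 0"
  proof (rule DERIV_nonpos_imp_decreasing_open[where f = f and a = 0 and b = t])
    show "0 \<le> t" using t by simp
    show "continuous_on {0..t} f" unfolding f_def using t
      by (intro continuous_intros continuous_on_subset[OF cz]) auto
    fix u assume u: "0 < u" "u < t"
    have dz: "(z has_vector_derivative g u) (at u)"
      using der[of u] u t at_within_interior[of u "{0..T}"] by auto
    have dz': "((\<lambda>u. z u \<bullet> z u) has_real_derivative 2 * (z u \<bullet> g u)) (at u)"
      using has_derivative_inner[OF dz[unfolded has_vector_derivative_def] dz[unfolded has_vector_derivative_def]]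
      unfolding has_field_derivative_def
      by (rule has_derivative_eq_rhs) (auto simp: inner_commute algebra_simps)
    have df: "(f has_real_derivative exp (- K * u) * (2 * (z u \<bullet> g u) - K * (z u \<bullet> z u + e\<^sup>2))) (at u)"
      unfolding f_def
      by (rule derivative_eq_intros dz' refl | simp)+ (auto simp: algebra_simps)
    have "z u \<bullet> g u \<le> norm (z u) * norm (g u)"
      by (rule norm_cauchy_schwarz)
    also have "\<dots> \<le> norm (z u) * (L * norm (z u) + e)"
      by (rule mult_left_mono) (use bnd[of u] u t in auto)
    finally have 1: "z u \<bullet> g u \<le> L * (norm (z u))\<^sup>2 + e * norm (z u)"
      by (simp add: algebra_simps power2_eq_square)
    have 2: "2 * (e * norm (z u)) \<le> e\<^sup>2 + (norm (z u))\<^sup>2"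
      using sum_squares_bound[of e "norm (z u)"] by simp
    have "2 * (z u \<bullet> g u) \<le> K * (norm (z u))\<^sup>2 + e\<^sup>2"
      using 1 2 unfolding K_def by (simp add: algebra_simps)
    also have "\<dots> \<le> K * (norm (z u))\<^sup>2 + K * e\<^sup>2"
      using mult_right_mono[of 1 K "e\<^sup>2"] \<open>0 \<le> L\<close> unfolding K_def by simp
    finally have "2 * (z u \<bullet> g u) - K * (z u \<bullet> z u + e\<^sup>2) \<le> 0"
      by (simp add: power2_norm_eq_inner algebra_simps)
    then show "\<exists>y. DERIV f u :> y \<and> y \<le> 0"
      using df by (meson exp_ge_zero mult_nonneg_nonpos)
  qed
  then have "(norm (z t))\<^sup>2 + e\<^sup>2 \<le> exp (K * t) * ((norm (z 0))\<^sup>2 + e\<^sup>2)"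
    unfolding f_def by (simp add: power2_norm_eq_inner exp_minus field_simps)
  \<comment> \<open>Rounding the exponent up from \<open>K * t\<close> makes the right-hand side a
    perfect square.\<close>
  also have "\<dots> \<le> exp (2 * (L + 1) * T) * (norm (z 0) + e)\<^sup>2"
  proof (rule mult_mono)
    have "K * t \<le> 2 * (L + 1) * t" unfolding K_def using t by (intro mult_right_mono) auto
    also have "\<dots> \<le> 2 * (L + 1) * T" using t \<open>0 \<le> L\<close> by (intro mult_left_mono) auto
    finally show "exp (K * t) \<le> exp (2 * (L + 1) * T)" by simp
    show "(norm (z 0))\<^sup>2 + e\<^sup>2 \<le> (norm (z 0) + e)\<^sup>2"
      using \<open>0 \<le> e\<close> by (simp add: power2_sum)
  qed auto
  also have "\<dots> = (exp ((L + 1) * T) * (norm (z 0) + e))\<^sup>2"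
    by (simp add: power_mult_distrib flip: exp_double)
  finally have "(norm (z t))\<^sup>2 \<le> (exp ((L + 1) * T) * (norm (z 0) + e))\<^sup>2"
    by (smt (verit) zero_le_power2)
  then show ?thesis
    by (rule power2_le_imp_le) (use \<open>0 \<le> e\<close> in auto)
qed

text \<open>Picard iteration. The Lipschitz bound holds on the whole space, so the iterates need no
  confinement and converge on all of \<open>{0..T}\<close>. \<open>F\<close> depends on time because
  the linearized equation along a trajectory is solved by the same lemma.\<close>

lemma picard_lindelof_exists:
  fixes F :: "real \<Rightarrow> 'a::euclidean_space \<Rightarrow> 'a"
  assumes "0 \<le> T" "0 \<le> L"
    and cont: "\<And>X. continuous_on {0..T} X \<Longrightarrow> continuous_on {0..T} (\<lambda>t. F t (X t))"
    and lip: "\<And>t x y. t \<in> {0..T} \<Longrightarrow> norm (F t x - F t y) \<le> L * norm (x - y)"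
  obtains X where "X 0 = x0"
    "\<And>t. t \<in> {0..T} \<Longrightarrow> (X has_vector_derivative F t (X t)) (at t within {0..T})"
proof -
  define I where "I = rec_nat (\<lambda>t. x0) (\<lambda>n X t. x0 + integral {0..t} (\<lambda>u. F u (X u)))"
  have I0: "I 0 = (\<lambda>t. x0)" and IS: "I (Suc n) = (\<lambda>t. x0 + integral {0..t} (\<lambda>u. F u (I n u)))" for n
    by (auto simp: I_def)
  have cI: "continuous_on {0..T} (I n)" for n
    by (induction n)
      (auto simp: I0 IS intro!: continuous_intros indefinite_integral_continuous_1
        integrable_continuous_real cont)
  have iF: "(\<lambda>u. F u (X u)) integrable_on {0..t}" if "continuous_on {0..T} X" "t \<in> {0..T}" for X t
    by (rule integrable_continuous_real, rule continuous_on_subset[OF cont[OF that(1)]]) (use that in auto)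
  obtain M where M: "\<And>u. u \<in> {0..T} \<Longrightarrow> norm (F u x0) \<le> M" "M > 0"
    using compact_imp_bounded[OF compact_continuous_image[OF cont[OF continuous_on_const[where c = x0]] compact_Icc]]
    unfolding bounded_pos by (metis imageI)
  \<comment> \<open>The usual factorial gain: integrating the n-th bound times the Lipschitz
    constant yields the next one, and the sum is dominated by an exponential series.\<close>
  have step: "norm (I (Suc n) t - I n t) \<le> M * T * (L * t) ^ n / fact n" if "t \<in> {0..T}" for n t
    using that
  proof (induction n arbitrary: t)
    case 0
    have "norm (integral {0..t} (\<lambda>u. F u x0)) \<le> integral {0..t} (\<lambda>u. M)"
      using 0 M by (intro integral_norm_bound_integral iF continuous_intros) auto
    also have "\<dots> \<le> M * T" using 0 M by (simp add: mult.commute)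
    finally show ?case by (simp add: I0 IS)
  next
    case (Suc n)
    have hi: "((\<lambda>u. L * (M * T * (L * u) ^ n / fact n)) has_integral
        (M * T * (L * t) ^ Suc n / fact (Suc n)) - (M * T * (L * 0) ^ Suc n / fact (Suc n))) {0..t}"
    proof (rule fundamental_theorem_of_calculus)
      show "0 \<le> t" using Suc by simp
      fix u :: real
      have "((\<lambda>u. M * T * (L * u) ^ Suc n / fact (Suc n)) has_real_derivative
          L * (M * T * (L * u) ^ n / fact n)) (at u within {0..t})"
        by (rule derivative_eq_intros refl | simp)+
      then show "((\<lambda>u. M * T * (L * u) ^ Suc n / fact (Suc n)) has_vector_derivative
          L * (M * T * (L * u) ^ n / fact n)) (at u within {0..t})"
        by (simp add: has_real_derivative_iff_has_vector_derivative)
    qed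
    have "I (Suc (Suc n)) t - I (Suc n) t
        = integral {0..t} (\<lambda>u. F u (I (Suc n) u) - F u (I n u))"
      by (subst (1 2) IS) (use Suc.prems in \<open>simp add: integral_diff[OF iF[OF cI] iF[OF cI]]\<close>)
    also have "norm \<dots> \<le> integral {0..t} (\<lambda>u. L * (M * T * (L * u) ^ n / fact n))"
    proof (rule integral_norm_bound_integral)
      show "(\<lambda>u. F u (I (Suc n) u) - F u (I n u)) integrable_on {0..t}"
        by (intro integrable_diff iF cI Suc.prems)
      show "(\<lambda>u. L * (M * T * (L * u) ^ n / fact n)) integrable_on {0..t}"
        using hi by (rule has_integral_integrable)
      fix u assume "u \<in> {0..t}"
      then have u: "u \<in> {0..T}" using Suc.prems by auto
      show "norm (F u (I (Suc n) u) - F u (I n u)) \<le> L * (M * T * (L * u) ^ n / fact n)"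
        using lip[OF u] mult_left_mono[OF Suc.IH[OF u] \<open>0 \<le> L\<close>] by (rule order_trans)
    qed
    also have "\<dots> = M * T * (L * t) ^ Suc n / fact (Suc n)"
      using integral_unique[OF hi] by simp
    finally show ?case .
  qed
  \<comment> \<open>Written as a telescoping series, the limit is accessible to the Weierstrass
    M-test, which makes the convergence uniform.\<close>
  define X where "X = (\<lambda>t. x0 + (\<Sum>n. I (Suc n) t - I n t))"
  have "uniform_limit {0..T} (\<lambda>n t. \<Sum>i<n. I (Suc i) t - I i t) (\<lambda>t. \<Sum>n. I (Suc n) t - I n t) sequentially"
  proof (rule Weierstrass_m_test)
    fix n t assume t: "t \<in> {0..T}"
    have "M * T * (L * t) ^ n / fact n \<le> M * T * (L * T) ^ n / fact n"
      using t M \<open>0 \<le> L\<close> by (intro divide_right_mono mult_left_mono power_mono) auto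
    then show "norm (I (Suc n) t - I n t) \<le> M * T * (L * T) ^ n / fact n"
      using step[OF t, of n] by linarith
  next
    show "summable (\<lambda>n. M * T * (L * T) ^ n / fact n)"
      using summable_mult[OF summable_exp[of "L * T"], of "M * T"] by (simp add: field_simps)
  qed
  then have "uniform_limit {0..T} (\<lambda>n t. I n t - x0) (\<lambda>t. \<Sum>n. I (Suc n) t - I n t) sequentially"
    by (subst (asm) sum_lessThan_telescope) (simp add: I0)
  from uniform_limit_add[OF uniform_limit_const this, of "\<lambda>_. x0"]
  have lim: "uniform_limit {0..T} I X sequentially"
    by (simp add: X_def)
  have cX: "continuous_on {0..T} X"
    using uniform_limit_theorem[OF _ lim] cI by auto
  have limF: "uniform_limit {0..T} (\<lambda>n u. F u (I n u)) (\<lambda>u. F u (X u)) sequentially"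
  proof (rule uniform_limitI)
    fix e :: real assume "e > 0"
    then have "e / (L + 1) > 0" using \<open>0 \<le> L\<close> by simp
    from uniform_limitD[OF lim this]
    show "\<forall>\<^sub>F n in sequentially. \<forall>u\<in>{0..T}. dist (F u (I n u)) (F u (X u)) < e"
    proof (rule eventually_mono, intro ballI)
      fix n u assume *: "\<forall>u\<in>{0..T}. dist (I n u) (X u) < e / (L + 1)" and u: "u \<in> {0..T}"
      have "dist (F u (I n u)) (F u (X u)) \<le> L * dist (I n u) (X u)"
        using lip[OF u] by (simp add: dist_norm)
      also have "\<dots> \<le> L * (e / (L + 1))"
        using * u \<open>0 \<le> L\<close> by (intro mult_left_mono) (auto simp: less_imp_le)
      also have "\<dots> < e" using \<open>e > 0\<close> \<open>0 \<le> L\<close> by (simp add: field_simps)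
      finally show "dist (F u (I n u)) (F u (X u)) < e" .
    qed
  qed
  have eq: "X t = x0 + integral {0..t} (\<lambda>u. F u (X u))" if t: "t \<in> {0..T}" for t
  proof (rule LIMSEQ_unique)
    show "(\<lambda>n. I (Suc n) t) \<longlonglongrightarrow> X t"
      using tendsto_uniform_limitI[OF lim t] by (rule LIMSEQ_Suc)
    have "uniform_limit {0..t} (\<lambda>n u. F u (I n u)) (\<lambda>u. F u (X u)) sequentially"
      by (rule uniform_limit_on_subset[OF limF]) (use t in auto)
    moreover have "continuous_on {0..t} (\<lambda>u. F u (I n u))" for n
      by (rule continuous_on_subset[OF cont[OF cI]]) (use t in auto)
    ultimately obtain Ia J where Ia: "\<And>n. ((\<lambda>u. F u (I n u)) has_integral Ia n) {0..t}"
      and J: "((\<lambda>u. F u (X u)) has_integral J) {0..t}" and "Ia \<longlonglongrightarrow> J"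
      using uniform_limit_integral[OF _ _ sequentially_bot] by blast
    then have "(\<lambda>n. integral {0..t} (\<lambda>u. F u (I n u))) \<longlonglongrightarrow> integral {0..t} (\<lambda>u. F u (X u))"
      by (simp only: integral_unique[OF Ia] integral_unique[OF J])
    then show "(\<lambda>n. I (Suc n) t) \<longlonglongrightarrow> x0 + integral {0..t} (\<lambda>u. F u (X u))"
      unfolding IS by (intro tendsto_intros)
  qed
  show ?thesis
  proof
    show "X 0 = x0" using eq[of 0] \<open>0 \<le> T\<close> by simp
    fix t assume t: "t \<in> {0..T}"
    have "((\<lambda>t. x0 + integral {0..t} (\<lambda>u. F u (X u))) has_vector_derivative 0 + F t (X t)) (at t within {0..T})"
      by (intro has_vector_derivative_add has_vector_derivative_const
          integral_has_vector_derivative cont cX t)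
    then show "(X has_vector_derivative F t (X t)) (at t within {0..T})"
      using has_vector_derivative_transform[OF t, of X] eq by simp
  qed
qed

section \<open>First hitting times, uniqueness, and evaluation of \<open>flow\<close>\<close>

lemma first_hitting_time:
  fixes f :: "real \<Rightarrow> real"
  assumes cont: "continuous_on {0..T} f" and "f 0 \<le> c" and t: "t \<in> {0..T}" "c \<le> f t"
  obtains \<tau> where "\<tau> \<in> {0..T}" "f \<tau> = c" "\<And>u. u \<in> {0..\<tau>} \<Longrightarrow> f u \<le> c"
proof -
  define S where "S = {u \<in> {0..T}. f u = c}"
  \<comment> \<open>By the intermediate value theorem, every time with value at least
    \<open>c\<close> has a hit of \<open>c\<close> at or before it. Hence \<open>f\<close> cannot
    exceed \<open>c\<close> before the earliest hit, which exists since \<open>S\<close> is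
    compact.\<close>
  have hit: "\<exists>x\<in>S. x \<le> u" if u: "u \<in> {0..T}" "c \<le> f u" for u
  proof -
    have cu: "continuous_on {0..u} f"
      by (rule continuous_on_subset[OF cont]) (use u in auto)
    then obtain x where "0 \<le> x" "x \<le> u" "f x = c"
      using IVT'[OF \<open>f 0 \<le> c\<close> u(2) _ cu] u(1) by auto
    then show ?thesis using u by (auto simp: S_def intro!: bexI[of _ x])
  qed
  have "closed S" unfolding S_def
    by (rule continuous_closed_preimage_constant[OF cont]) simp
  moreover have "bounded S"
    by (rule bounded_subset[of "{0..T}"]) (auto simp: S_def)
  ultimately have "compact S" by (simp add: compact_eq_bounded_closed)
  moreover have "S \<noteq> {}" using hit[OF t] by auto
  ultimately obtain \<tau> where \<tau>: "\<tau> \<in> S" "\<And>u. u \<in> S \<Longrightarrow> \<tau> \<le> u"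
    using compact_attains_inf[of S] by metis
  show ?thesis
  proof
    show "\<tau> \<in> {0..T}" "f \<tau> = c" using \<tau> by (auto simp: S_def)
    fix u assume u: "u \<in> {0..\<tau>}"
    show "f u \<le> c"
    proof (rule ccontr)
      assume "\<not> f u \<le> c"
      then obtain x where "x \<in> S" "x \<le> u" using hit[of u] u \<open>\<tau> \<in> {0..T}\<close> by auto
      then have "u = \<tau>" using \<tau>(2) u by fastforce
      then show False using \<open>\<not> f u \<le> c\<close> \<open>f \<tau> = c\<close> by simp
    qed
  qed
qed

lemma lipschitz_solutions_agree:
  fixes w :: "'a::euclidean_space \<Rightarrow> 'a"
  assumes lip: "L-lipschitz_on S w"
    and X: "\<And>u. u \<in> {0..T} \<Longrightarrow> X u \<in> S"
      "\<And>u. u \<in> {0..T} \<Longrightarrow> (X has_vector_derivative w (X u)) (at u within {0..T})"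
    and Y: "\<And>u. u \<in> {0..T} \<Longrightarrow> Y u \<in> S"
      "\<And>u. u \<in> {0..T} \<Longrightarrow> (Y has_vector_derivative w (Y u)) (at u within {0..T})"
    and u: "u \<in> {0..T}"
  shows "norm (Y u - X u) \<le> exp ((L + 1) * T) * norm (Y 0 - X 0)"
proof -
  have "norm (Y u - X u) \<le> exp ((L + 1) * T) * (norm (Y 0 - X 0) + 0)"
  proof (rule gronwall_norm[where g = "\<lambda>u. w (Y u) - w (X u)"])
    fix t assume t: "t \<in> {0..T}"
    show "((\<lambda>u. Y u - X u) has_vector_derivative w (Y t) - w (X t)) (at t within {0..T})"
      using X(2)[OF t] Y(2)[OF t] by (rule has_vector_derivative_diff[rotated])
    show "norm (w (Y t) - w (X t)) \<le> L * norm (Y t - X t) + 0"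
      using lipschitz_onD[OF lip Y(1)[OF t] X(1)[OF t]] by (simp add: dist_norm)
  qed (use u lipschitz_on_nonneg[OF lip] in auto)
  then show ?thesis by simp
qed

text \<open>The second curve is not assumed to stay near \<open>p\<close>: up to the first time it reaches
  the sphere of radius \<open>r\<close> it agrees with the first, which never gets that far.\<close>

lemma integral_curve_unique:
  fixes w :: "'a::euclidean_space \<Rightarrow> 'a"
  assumes lip: "L-lipschitz_on (cball p r) w" and "a < r"
    and X: "\<And>u. u \<in> {0..T} \<Longrightarrow> X u \<in> cball p a"
      "\<And>u. u \<in> {0..T} \<Longrightarrow> (X has_vector_derivative w (X u)) (at u within {0..T})"
    and Y: "Y 0 = X 0" "\<And>u. u \<in> {0..T} \<Longrightarrow> (Y has_vector_derivative w (Y u)) (at u within {0..T})"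
    and u: "u \<in> {0..T}"
  shows "Y u = X u"
proof -
  have agree: "Y x = X x" if "\<tau> \<in> {0..T}" "x \<in> {0..\<tau>}" "\<And>u. u \<in> {0..\<tau>} \<Longrightarrow> dist p (Y u) \<le> r" for \<tau> x
  proof -
    have "norm (Y x - X x) \<le> exp ((L + 1) * \<tau>) * norm (Y 0 - X 0)"
    proof (rule lipschitz_solutions_agree[OF lip _ _ _ _ that(2)])
      fix s assume s: "s \<in> {0..\<tau>}"
      then have sT: "s \<in> {0..T}" and sub: "{0..\<tau>} \<subseteq> {0..T}" using that by auto
      show "X s \<in> cball p r" using X(1)[OF sT] \<open>a < r\<close> by simp
      show "Y s \<in> cball p r" using that(3)[OF s] by simp
      show "(X has_vector_derivative w (X s)) (at s within {0..\<tau>})"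
        "(Y has_vector_derivative w (Y s)) (at s within {0..\<tau>})"
        using X(2)[OF sT] Y(2)[OF sT] sub has_vector_derivative_within_subset by blast+
    qed
    then show ?thesis using Y(1) by simp
  qed
  have cY: "continuous_on {0..T} (\<lambda>u. dist p (Y u))"
    using Y(2) by (intro continuous_intros) (meson continuous_on_vector_derivative)
  have "dist p (Y u) < r" if u: "u \<in> {0..T}" for u
  proof (rule ccontr)
    assume "\<not> dist p (Y u) < r"
    then have "r \<le> dist p (Y u)" by simp
    moreover have "dist p (Y 0) \<le> r" using X(1)[of 0] u \<open>a < r\<close> Y(1) by auto
    ultimately obtain \<tau> where \<tau>: "\<tau> \<in> {0..T}" "dist p (Y \<tau>) = r" "\<And>u. u \<in> {0..\<tau>} \<Longrightarrow> dist p (Y u) \<le> r"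
      using first_hitting_time[OF cY _ u] by blast
    then have "Y \<tau> = X \<tau>" using agree[of \<tau> \<tau>] by auto
    then show False using X(1)[OF \<tau>(1)] \<tau>(2) \<open>a < r\<close> by simp
  qed
  then show ?thesis using agree[of T u] u by (auto simp: less_imp_le)
qed

text \<open>\<open>flow\<close> ranges over all integral curves in \<open>U\<close>, so a known
  solution identifies it only once every competitor is excluded. The margin between \<open>a\<close>
  and \<open>r\<close> serves this purpose, as a competitor might a priori leave
  \<open>cball p a\<close>.\<close>

lemma flow_of_solution:
  fixes w :: "'a::euclidean_space \<Rightarrow> 'a"
  assumes lip: "L-lipschitz_on (cball p r) w" and "a < r" and "cball p a \<subseteq> U" and "0 \<le> T"
    and X: "\<And>u. u \<in> {0..T} \<Longrightarrow> X u \<in> cball p a"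
      "\<And>u. u \<in> {0..T} \<Longrightarrow> (X has_vector_derivative w (X u)) (at u within {0..T})"
  shows "flow_exists U w T (X 0)"
    and "flow U w T (X 0) = X T"
    and "flow_length U w T (X 0) = integral {0..T} (\<lambda>u. norm (w (X u)))"
proof -
  have curve: "integral_curve U w t (X 0) X" if "t \<in> {0..T}" for t
    unfolding integral_curve_def closed_segment_eq_real_ivl
    using that X(1) assms(3) by (auto intro!: has_vector_derivative_within_subset[OF X(2), of _ "{0..t}"])
  have flow: "flow U w t (X 0) = X t" if t: "t \<in> {0..T}" for t
    unfolding flow_def
  proof (rule the_equality)
    show "\<exists>\<gamma>. integral_curve U w t (X 0) \<gamma> \<and> \<gamma> t = X t" using curve[OF t] by blast
    fix y assume "\<exists>\<gamma>. integral_curve U w t (X 0) \<gamma> \<and> \<gamma> t = y"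
    then obtain Y where Y: "integral_curve U w t (X 0) Y" "Y t = y" by blast
    have "Y t = X t"
    proof (rule integral_curve_unique[OF lip \<open>a < r\<close>, of t])
      fix u assume "u \<in> {0..t}"
      then have u: "u \<in> {0..T}" using t by auto
      show "X u \<in> cball p a" by (rule X(1)[OF u])
      show "(X has_vector_derivative w (X u)) (at u within {0..t})"
        using has_vector_derivative_within_subset[OF X(2)[OF u]] t by auto
    qed (use t Y in \<open>auto simp: integral_curve_def closed_segment_eq_real_ivl\<close>)
    then show "y = X t" using Y by simp
  qed
  show "flow_exists U w T (X 0)" using curve[of T] \<open>0 \<le> T\<close> by (auto simp: flow_exists_def)
  show "flow U w T (X 0) = X T" using flow \<open>0 \<le> T\<close> by simp
  show "flow_length U w T (X 0) = integral {0..T} (\<lambda>u. norm (w (X u)))"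
  proof (cases "T = 0")
    \<comment> \<open>Within the one-point set {0} the value of \<open>vector_derivative\<close> is
      not determined, but the integral over that set vanishes.\<close>
    case True
    have z: "integral {0..T} g = 0" for g :: "real \<Rightarrow> real"
      unfolding True by (rule integral_unique) (simp add: has_integral_refl)
    show ?thesis unfolding flow_length_def by (rule trans[OF z z[symmetric]])
  next
    case False
    show ?thesis unfolding flow_length_def
    proof (rule integral_cong)
      fix u assume u: "u \<in> {0..T}"
      have "((\<lambda>r. flow U w r (X 0)) has_vector_derivative w (X u)) (at u within {0..T})"
        by (rule has_vector_derivative_transform[OF u _ X(2)[OF u]]) (rule flow)
      then show "norm (vector_derivative (\<lambda>r. flow U w r (X 0)) (at u within {0..T})) = norm (w (X u))"
        using vector_derivative_within_closed_interval[of 0 T u] False \<open>0 \<le> T\<close> u by force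
    qed
  qed
qed

lemma projected_solution_exists:
  fixes w :: "'a::euclidean_space \<Rightarrow> 'a"
  assumes lip: "L-lipschitz_on (cball p a) w" and "0 \<le> a" and "0 \<le> T"
  obtains X where "X 0 = x"
    "\<And>t. t \<in> {0..T} \<Longrightarrow>
      (X has_vector_derivative w (closest_point (cball p a) (X t))) (at t within {0..T})"
proof -
  let ?P = "closest_point (cball p a)"
  have P: "?P x \<in> cball p a" for x
    by (rule closest_point_in_set) (use \<open>0 \<le> a\<close> in auto)
  have bnd: "norm (w (?P x) - w (?P y)) \<le> L * norm (x - y)" for x y
  proof -
    have "dist (w (?P x)) (w (?P y)) \<le> L * dist (?P x) (?P y)"
      by (rule lipschitz_onD[OF lip P P])
    \<comment> \<open>The nearest-point projection onto a convex set does not increase distances, so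
      the constant stays \<open>L\<close>.\<close>
    also have "\<dots> \<le> L * dist x y"
      by (intro mult_left_mono closest_point_lipschitz lipschitz_on_nonneg[OF lip]) (use \<open>0 \<le> a\<close> in auto)
    finally show ?thesis by (simp add: dist_norm)
  qed
  have "L-lipschitz_on UNIV (\<lambda>x. w (?P x))"
    using bnd lipschitz_on_nonneg[OF lip] by (intro lipschitz_onI) (auto simp: dist_norm)
  then have "continuous_on UNIV (\<lambda>x. w (?P x))"
    by (rule lipschitz_on_continuous_on)
  then have "continuous_on {0..T} (\<lambda>t. w (?P (X t)))" if "continuous_on {0..T} X" for X
    using that by (rule continuous_on_compose2) auto
  then obtain X where "X 0 = x"
    "\<And>t. t \<in> {0..T} \<Longrightarrow> (X has_vector_derivative w (?P (X t))) (at t within {0..T})"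
    by (rule picard_lindelof_exists[OF \<open>0 \<le> T\<close> lipschitz_on_nonneg[OF lip], of "\<lambda>t x. w (?P x)" x])
       (use bnd in auto)
  then show ?thesis by (rule that)
qed

section \<open>Continuously differentiable fields\<close>

lemma smooth_on_imp_C1:
  assumes "smooth_on U f"
  shows "x \<in> U \<Longrightarrow> (f has_derivative frechet_derivative f (at x)) (at x)"
    and "continuous_on U (\<lambda>x. frechet_derivative f (at x) h)"
  using assms[unfolded smooth_on_def, rule_format, of "Suc 0"]
  by (auto simp: frechet_derivative_works)

text \<open>Continuity is asked for each fixed direction \<open>h\<close>, the form that
  \<open>smooth_on\<close> provides; a finite basis turns it into control of the operator
  norm.\<close>

locale C1_field =
  fixes U :: "'a::euclidean_space set" and f :: "'a \<Rightarrow> 'b::real_normed_vector"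
    and D :: "'a \<Rightarrow> 'a \<Rightarrow> 'b"
  assumes der: "x \<in> U \<Longrightarrow> (f has_derivative D x) (at x)"
    and cont: "continuous_on U (\<lambda>x. D x h)"
begin

lemma continuous_on_f: "continuous_on U f"
  by (meson der has_derivative_continuous_on has_derivative_at_withinI)

lemma D_diff_bound:
  assumes "x \<in> U" "y \<in> U"
  shows "norm (D x h - D y h) \<le> (\<Sum>b\<in>Basis. norm (D x b - D y b)) * norm h"
proof -
  interpret x: bounded_linear "D x" by (rule has_derivative_bounded_linear[OF der[OF assms(1)]])
  interpret y: bounded_linear "D y" by (rule has_derivative_bounded_linear[OF der[OF assms(2)]])
  have "D x h - D y h = D x (\<Sum>b\<in>Basis. (h \<bullet> b) *\<^sub>R b) - D y (\<Sum>b\<in>Basis. (h \<bullet> b) *\<^sub>R b)"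
    by (simp add: euclidean_representation)
  also have "\<dots> = (\<Sum>b\<in>Basis. (h \<bullet> b) *\<^sub>R (D x b - D y b))"
    by (simp add: x.sum y.sum x.scaleR y.scaleR sum_subtractf scaleR_diff_right)
  also have "norm \<dots> \<le> (\<Sum>b\<in>Basis. norm (D x b - D y b) * norm h)"
    by (rule sum_norm_le) (auto simp: mult.commute[of _ "norm h"] intro!: mult_right_mono Basis_le_norm)
  finally show ?thesis by (simp add: sum_distrib_right)
qed

lemma D_bounded:
  assumes "compact K" "K \<subseteq> U"
  obtains B where "0 \<le> B" "\<And>x h. x \<in> K \<Longrightarrow> norm (D x h) \<le> B * norm h"
proof -
  have "continuous_on K (\<lambda>x. \<Sum>b\<in>Basis. norm (D x b))"
    by (intro continuous_intros continuous_on_subset[OF cont] assms(2))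
  from compact_imp_bounded[OF compact_continuous_image[OF this assms(1)]]
  obtain B where B: "B > 0" "\<And>x. x \<in> K \<Longrightarrow> norm (\<Sum>b\<in>Basis. norm (D x b)) \<le> B"
    unfolding bounded_pos by auto
  have B: "B > 0" "\<And>x. x \<in> K \<Longrightarrow> (\<Sum>b\<in>Basis. norm (D x b)) \<le> B"
    using B by (auto simp: abs_le_iff)
  have "norm (D x h) \<le> B * norm h" if x: "x \<in> K" for x h
  proof -
    interpret x: bounded_linear "D x"
      by (rule has_derivative_bounded_linear[OF der]) (use x assms in auto)
    have "norm (D x h) = norm (D x (\<Sum>b\<in>Basis. (h \<bullet> b) *\<^sub>R b))"
      by (simp add: euclidean_representation)
    also have "\<dots> = norm (\<Sum>b\<in>Basis. (h \<bullet> b) *\<^sub>R D x b)"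
      by (simp add: x.sum x.scaleR)
    also have "\<dots> \<le> (\<Sum>b\<in>Basis. norm (D x b) * norm h)"
      by (rule sum_norm_le) (auto simp: mult.commute[of _ "norm h"] intro!: mult_right_mono Basis_le_norm)
    also have "\<dots> \<le> B * norm h"
      using B(2)[OF x] by (simp add: mult_right_mono flip: sum_distrib_right)
    finally show ?thesis .
  qed
  then show ?thesis using B(1) that[of B] by simp
qed

lemma lipschitz:
  assumes "compact K" "K \<subseteq> U" "convex K"
  obtains L where "L-lipschitz_on K f" "\<And>x h. x \<in> K \<Longrightarrow> norm (D x h) \<le> L * norm h"
proof -
  obtain B where B: "0 \<le> B" "\<And>x h. x \<in> K \<Longrightarrow> norm (D x h) \<le> B * norm h"
    using D_bounded[OF assms(1,2)] by blast
  have "norm (f x - f y) \<le> B * norm (x - y)" if "x \<in> K" "y \<in> K" for x y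
    using assms(2) B
    by (intro differentiable_bound[OF assms(3) has_derivative_at_withinI[OF der] onorm_le that]) auto
  then have "B-lipschitz_on K f"
    by (intro lipschitz_onI B(1)) (simp add: dist_norm)
  with B(2) show ?thesis using that by blast
qed

text \<open>\<open>D\<close> is uniformly continuous on the compact set \<open>K\<close>. Convexity
  keeps the segment from \<open>x\<close> to \<open>y\<close> in \<open>K\<close>, so the mean value
  inequality bounds the linearization error by the oscillation of \<open>D\<close> along it.\<close>

lemma uniformly_differentiable:
  assumes "compact K" "K \<subseteq> U" "convex K" "0 < e"
  obtains d where "0 < d"
    "\<And>x y. x \<in> K \<Longrightarrow> y \<in> K \<Longrightarrow> norm (y - x) < d \<Longrightarrow> norm (f y - f x - D x (y - x)) \<le> e * norm (y - x)"
proof -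
  let ?n = "real (DIM('a))"
  have n: "0 < ?n" by simp
  have "\<forall>b. \<exists>d. 0 < d \<and> (\<forall>x\<in>K. \<forall>y\<in>K. dist y x < d \<longrightarrow> dist (D y b) (D x b) < e / ?n)"
  proof
    fix b
    show "\<exists>d. 0 < d \<and> (\<forall>x\<in>K. \<forall>y\<in>K. dist y x < d \<longrightarrow> dist (D y b) (D x b) < e / ?n)"
      using compact_uniformly_continuous[OF continuous_on_subset[OF cont assms(2)] assms(1), of b]
      unfolding uniformly_continuous_on_def by (rule allE) (use divide_pos_pos[OF assms(4) n] in blast)
  qed
  from choice[OF this]
  obtain d where d: "\<And>b. d b > 0"
    "\<And>b x y. x \<in> K \<Longrightarrow> y \<in> K \<Longrightarrow> dist y x < d b \<Longrightarrow> dist (D y b) (D x b) < e / ?n"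
    by blast
  define d0 where "d0 = Min (d ` Basis)"
  have d0: "d0 > 0" "\<And>b. b \<in> Basis \<Longrightarrow> d0 \<le> d b"
    using d(1) by (auto simp: d0_def)
  have "norm (f y - f x - D x (y - x)) \<le> e * norm (y - x)"
    if xy: "x \<in> K" "y \<in> K" "norm (y - x) < d0" for x y
  proof -
    have seg: "x + t *\<^sub>R (y - x) \<in> K \<inter> ball x d0" if "t \<in> {0..1}" for t
    proof -
      have "x + t *\<^sub>R (y - x) = (1 - t) *\<^sub>R x + t *\<^sub>R y" by (simp add: algebra_simps)
      then have "x + t *\<^sub>R (y - x) \<in> K"
        using that convexD[OF assms(3) xy(1,2), of "1 - t" t] by simp
      moreover have "norm (t *\<^sub>R (y - x)) \<le> norm (y - x)"
        using that by (simp add: mult_left_le_one_le)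
      then have "x + t *\<^sub>R (y - x) \<in> ball x d0"
        using xy(3) by (simp add: dist_norm)
      ultimately show ?thesis by simp
    qed
    have "norm (f y - f x - D x (y - x)) \<le> norm (y - x) * e"
    proof (rule differentiable_bound_linearization[where f' = D and ?x0.0 = x, OF seg])
      show "(f has_derivative D z) (at z within K \<inter> ball x d0)" if "z \<in> K \<inter> ball x d0" for z
        by (rule has_derivative_at_withinI[OF der]) (use that assms(2) in auto)
      show "onorm (D z - D x) \<le> e" if z: "z \<in> K \<inter> ball x d0" for z
      proof (rule onorm_le)
        fix h :: 'a
        have zU: "z \<in> U" and xU: "x \<in> U" using z xy(1) assms(2) by auto
        have "(\<Sum>b\<in>Basis. norm (D z b - D x b)) \<le> (\<Sum>b\<in>(Basis::'a set). e / ?n)"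
        proof (rule sum_mono)
          fix b :: 'a assume "b \<in> Basis"
          then have "dist z x < d b" using z d0(2)[of b] by (auto simp: dist_commute)
          then show "norm (D z b - D x b) \<le> e / ?n"
            using d(2)[of x z b] z xy(1) by (auto simp: dist_norm)
        qed
        also have "\<dots> = e" using n by simp
        finally have "(\<Sum>b\<in>Basis. norm (D z b - D x b)) * norm h \<le> e * norm h"
          by (rule mult_right_mono) simp
        then show "norm ((D z - D x) h) \<le> e * norm h"
          using order_trans[OF D_diff_bound[OF zU xU]] by (simp add: minus_apply)
      qed
      show "x \<in> K \<inter> ball x d0" using xy(1) d0(1) by simp
    qed
    then show ?thesis by (simp add: mult.commute)
  qed
  with d0(1) show ?thesis using that by blast
qed

end

lemma smooth_on_imp_C1_field:
  "smooth_on U f \<Longrightarrow> C1_field U f (\<lambda>x. frechet_derivative f (at x))"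
  by unfold_locales (rule smooth_on_imp_C1; assumption)+

text \<open>By compactness a whole neighbourhood of the closed disc fits into \<open>U\<close>. This
  makes room for the uniqueness argument, which needs a Lipschitz bound on a strictly larger
  ball.\<close>

lemma cball_enlarge:
  fixes p :: "'a::euclidean_space"
  assumes "open U" "cball p a \<subseteq> U" "0 \<le> a"
  obtains r where "a < r" "cball p r \<subseteq> U"
proof -
  obtain e where e: "e > 0" "(\<Union>x\<in>cball p a. ball x e) \<subseteq> U"
    using compact_subset_open_imp_ball_epsilon_subset[OF compact_cball assms(1,2)] by blast
  have "y \<in> U" if y: "y \<in> cball p (a + e / 2)" for y
  proof -
    let ?q = "closest_point (cball p a) y"
    have "y \<in> ball ?q e"
    proof (cases "y \<in> cball p a")
      case True
      then show ?thesis using e(1) by (simp add: closest_point_self)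
    next
      case False
      \<comment> \<open>The radial projection of \<open>y\<close>: an explicit point of the disc at
        distance \<open>dist p y - a\<close>, which bounds the distance to the closest
        point.\<close>
      define z where "z = p + (a / dist p y) *\<^sub>R (y - p)"
      have dy: "dist p y > a" "dist p y > 0" using False \<open>0 \<le> a\<close> by auto
      have z: "z \<in> cball p a" using dy \<open>0 \<le> a\<close> by (simp add: z_def dist_norm norm_minus_commute)
      have "y - z = (1 - a / dist p y) *\<^sub>R (y - p)" by (simp add: z_def algebra_simps)
      then have "dist y z = \<bar>1 - a / dist p y\<bar> * dist p y"
        by (simp add: dist_norm norm_minus_commute)
      also have "\<dots> = dist p y - a" using dy by (simp add: field_simps)
      also have "\<dots> < e" using y e(1) by simp
      finally have "dist y z < e" .
      then have "dist y ?q < e"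
        using closest_point_le[OF closed_cball z, of y] by simp
      then show ?thesis by (simp add: dist_commute)
    qed
    moreover have "?q \<in> cball p a"
      by (rule closest_point_in_set) (use \<open>0 \<le> a\<close> in auto)
    ultimately show ?thesis using e(2) by blast
  qed
  then have "cball p (a + e / 2) \<subseteq> U" by blast
  moreover have "a < a + e / 2" using e(1) by simp
  ultimately show ?thesis by (rule that[rotated])
qed

section \<open>The stream function of a divergence-free planar field\<close>

text \<open>The planar area form, that is, the determinant with columns \<open>a\<close> and
  \<open>b\<close>. As a form in its second argument, \<open>cross2 (v x)\<close> measures the flux
  of \<open>v\<close> across a small displacement.\<close>

definition cross2 :: "real ^ 2 \<Rightarrow> real ^ 2 \<Rightarrow> real" where
  "cross2 a b = a $ 1 * b $ 2 - a $ 2 * b $ 1"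

lemma bounded_bilinear_cross2: "bounded_bilinear cross2"
  unfolding bilinear_conv_bounded_bilinear[symmetric] bilinear_def
  by (auto intro!: linearI simp: cross2_def algebra_simps)

lemmas continuous_on_cross2 [continuous_intros] =
  bounded_bilinear.continuous_on[OF bounded_bilinear_cross2]

lemma vec2_eq_axis: "h = h $ 1 *\<^sub>R axis 1 1 + h $ 2 *\<^sub>R axis 2 (1::real)" for h :: "real ^ 2"
  by (simp add: vec_eq_iff forall_2 axis_def)

text \<open>A traceless map preserves the area form infinitesimally,
  \<open>cross2 (A a) b + cross2 a (A b) = 0\<close>; antisymmetry gives the form stated. It is the
  reason both for the existence of the stream function and for the constancy of the Jacobian along
  trajectories.\<close>

lemma cross2_traceless:
  assumes "linear A" and tr: "A (axis 1 1) $ 1 + A (axis 2 1) $ 2 = 0"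
  shows "cross2 (A a) b = cross2 (A b) a"
proof -
  have A: "A h $ i = h $ 1 * A (axis 1 1) $ i + h $ 2 * A (axis 2 1) $ i" for h :: "real ^ 2" and i
    by (subst vec2_eq_axis[of h]) (simp add: linear_add[OF assms(1)] linear_cmul[OF assms(1)])
  have 2: "A (axis 2 1) $ 2 = - A (axis 1 1) $ 1" using tr by simp
  show ?thesis unfolding cross2_def A[of a] A[of b] 2 by (simp add: algebra_simps)
qed

lemma cross2_self [simp]: "cross2 a a = 0"
  by (simp add: cross2_def)

lemma cross2_perp: "cross2 (v x) (perp_field v x) = (norm (v x))\<^sup>2"
  by (simp add: cross2_def perp_field_def power2_norm_eq_inner inner_vec_def sum_2)

lemma norm_perp_field [simp]: "norm (perp_field v x) = norm (v x)"
  by (simp add: perp_field_def norm_eq_sqrt_inner inner_vec_def sum_2 add.commute)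

lemma cross2_nondegenerate: "(\<And>h. cross2 a h = 0) \<Longrightarrow> a = 0"
  using cross2_perp[of "\<lambda>_. a" undefined] by simp

lemma partial_deriv_eq:
  assumes "(v has_derivative A) (at x)"
  shows "partial_deriv i (\<lambda>y. v y $ i) x = A (axis i 1) $ i"
proof -
  have A: "linear A" using assms by (rule has_derivative_linear)
  have "((\<lambda>h. x + h *\<^sub>R axis i 1) has_derivative (\<lambda>h. h *\<^sub>R axis i (1::real))) (at 0)"
    by (auto intro!: derivative_eq_intros)
  then have "((\<lambda>h. v (x + h *\<^sub>R axis i 1)) has_derivative (\<lambda>h. A (h *\<^sub>R axis i 1))) (at 0)"
    by (rule has_derivative_compose) (simp add: assms)
  from bounded_linear.has_derivative[OF bounded_linear_vec_nth this, of i]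
  have "((\<lambda>h. v (x + h *\<^sub>R axis i 1) $ i) has_real_derivative A (axis i 1) $ i) (at 0)"
    unfolding has_field_derivative_def
    by (rule has_derivative_eq_rhs) (auto simp: linear_cmul[OF A])
  then show ?thesis unfolding partial_deriv_def by (rule DERIV_imp_deriv)
qed

locale divergence_free_field = C1_field U v D
  for U :: "(real ^ 2) set" and v :: "real ^ 2 \<Rightarrow> real ^ 2" and D +
  fixes p :: "real ^ 2"
  assumes disc: "cball p 1 \<subseteq> U"
    and traceless: "x \<in> U \<Longrightarrow> D x (axis 1 1) $ 1 + D x (axis 2 1) $ 2 = 0"
begin

lemma linear_D: "x \<in> U \<Longrightarrow> linear (D x)"
  using der has_derivative_linear by blast

lemma cross2_D: "x \<in> U \<Longrightarrow> cross2 (D x a) b = cross2 (D x b) a"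
  by (rule cross2_traceless[OF linear_D traceless])

text \<open>The flux of \<open>v\<close> through the segment from \<open>p\<close> to \<open>x\<close>.\<close>

definition stream :: "real ^ 2 \<Rightarrow> real" where
  "stream x = integral {0..1} (\<lambda>\<tau>. cross2 (v (p + \<tau> *\<^sub>R (x - p))) (x - p))"

text \<open>The Poincare lemma for the flux form, which is closed because the divergence vanishes.
  After differentiation under the integral, tracelessness exchanges \<open>h\<close> and
  \<open>x - p\<close> in the term with \<open>D\<close>. The integrand becomes the
  \<tau>-derivative of \<tau> times the flux form at the point with parameter \<tau>, so only the
  endpoint \<tau> = 1 contributes.\<close>

lemma has_derivative_stream:
  assumes x: "x \<in> ball p 1"
  shows "(stream has_derivative cross2 (v x)) (at x)"
proof -
  interpret c: bounded_bilinear cross2 by (rule bounded_bilinear_cross2)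
  let ?q = "\<lambda>x \<tau>. p + \<tau> *\<^sub>R (x - p)"
  define g where "g = (\<lambda>x \<tau> h. cross2 (v (?q x \<tau>)) h + \<tau> * cross2 (D (?q x \<tau>) h) (x - p))"
  have q: "?q x \<tau> \<in> U" if "x \<in> ball p 1" "\<tau> \<in> {0..1}" for x \<tau>
  proof -
    have "\<tau> * norm (x - p) \<le> 1"
      using that by (intro mult_le_one) (auto simp: dist_norm norm_minus_commute)
    then have "?q x \<tau> \<in> cball p 1" using that by (simp add: dist_norm)
    then show ?thesis using disc by blast
  qed
  have bl: "bounded_linear (g x \<tau>)" if "x \<in> ball p 1" "\<tau> \<in> {0..1}" for x \<tau>
    unfolding g_def using has_derivative_bounded_linear[OF der[OF q[OF that]]]
    by (intro bounded_linear_add c.bounded_linear_right bounded_linear_const_mult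
        bounded_linear_compose[OF c.bounded_linear_left])
  have cq: "continuous_on (ball p 1 \<times> {0..1}) (\<lambda>z. f (?q (fst z) (snd z)))"
    if "continuous_on U f" for f :: "real ^ 2 \<Rightarrow> real ^ 2"
    by (rule continuous_on_compose2[OF that]) (auto intro!: continuous_intros q[simplified])
  have dg: "((\<lambda>x. cross2 (v (?q x \<tau>)) (x - p)) has_derivative blinfun_apply (Blinfun (g x \<tau>))) (at x within ball p 1)"
    if x: "x \<in> ball p 1" and t: "\<tau> \<in> cbox 0 1" for x \<tau>
  proof -
    have t: "\<tau> \<in> {0..1}" using t by simp
    have "((\<lambda>x. ?q x \<tau>) has_derivative (\<lambda>h. \<tau> *\<^sub>R h)) (at x within ball p 1)"
      by (auto intro!: derivative_eq_intros)
    from has_derivative_compose[OF this der[OF q[OF x t]]]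
    have "((\<lambda>x. v (?q x \<tau>)) has_derivative (\<lambda>h. D (?q x \<tau>) (\<tau> *\<^sub>R h))) (at x within ball p 1)" .
    moreover have "((\<lambda>x. x - p) has_derivative (\<lambda>h. h)) (at x within ball p 1)"
      by (auto intro!: derivative_eq_intros)
    ultimately have "((\<lambda>x. cross2 (v (?q x \<tau>)) (x - p)) has_derivative
        (\<lambda>h. cross2 (v (?q x \<tau>)) h + cross2 (D (?q x \<tau>) (\<tau> *\<^sub>R h)) (x - p))) (at x within ball p 1)"
      by (rule c.FDERIV)
    then show ?thesis
      unfolding bounded_linear_Blinfun_apply[OF bl[OF x t]] unfolding g_def
      by (simp add: linear_cmul[OF linear_D[OF q[OF x t]]] c.scaleR_left)
  qed
  have ig: "((\<lambda>\<tau>. g x \<tau> h) has_integral cross2 (v x) h) {0..1}" for h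
  proof -
    have "((\<lambda>\<tau>. g x \<tau> h) has_integral 1 *\<^sub>R cross2 (v (?q x 1)) h - 0 *\<^sub>R cross2 (v (?q x 0)) h) {0..1}"
    proof (rule fundamental_theorem_of_calculus)
      fix \<tau> :: real assume t: "\<tau> \<in> {0..1}"
      have "((\<lambda>\<tau>. ?q x \<tau>) has_derivative (\<lambda>h. h *\<^sub>R (x - p))) (at \<tau> within {0..1})"
        by (auto intro!: derivative_eq_intros)
      from has_derivative_compose[OF this der[OF q[OF x t]]]
      have "((\<lambda>\<tau>. v (?q x \<tau>)) has_vector_derivative D (?q x \<tau>) (x - p)) (at \<tau> within {0..1})"
        unfolding has_vector_derivative_def by (simp add: linear_cmul[OF linear_D[OF q[OF x t]]])
      then have "((\<lambda>\<tau>. cross2 (v (?q x \<tau>)) h) has_vector_derivative cross2 (D (?q x \<tau>) (x - p)) h) (at \<tau> within {0..1})"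
        by (rule bounded_linear.has_vector_derivative[OF c.bounded_linear_left])
      then have "((\<lambda>\<tau>. \<tau> *\<^sub>R cross2 (v (?q x \<tau>)) h) has_vector_derivative
          \<tau> *\<^sub>R cross2 (D (?q x \<tau>) (x - p)) h + 1 *\<^sub>R cross2 (v (?q x \<tau>)) h) (at \<tau> within {0..1})"
        by (intro has_vector_derivative_scaleR) (auto intro!: derivative_eq_intros)
      then show "((\<lambda>\<tau>. \<tau> *\<^sub>R cross2 (v (?q x \<tau>)) h) has_vector_derivative g x \<tau> h) (at \<tau> within {0..1})"
        by (simp add: g_def cross2_D[OF q[OF x t], of "x - p" h] add.commute)
    qed simp
    then show ?thesis by simp
  qed
  \<comment> \<open>The Leibniz rule asks for a derivative that is continuous as a bounded operator;
    in finite dimension continuity in each direction \<open>h\<close> suffices.\<close>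
  have cg: "continuous_on (ball p 1 \<times> cbox 0 1) (\<lambda>(x, \<tau>). Blinfun (g x \<tau>))"
  proof (rule continuous_on_blinfun_componentwise)
    fix h :: "real ^ 2"
    have "continuous_on (ball p 1 \<times> {0..1}) (\<lambda>z. g (fst z) (snd z) h)"
      unfolding g_def by (intro continuous_intros cq[OF continuous_on_f] cq[OF cont])
    then show "continuous_on (ball p 1 \<times> cbox 0 1) (\<lambda>z. blinfun_apply (case z of (x, \<tau>) \<Rightarrow> Blinfun (g x \<tau>)) h)"
      unfolding box_real
      by (rule continuous_on_eq) (auto simp: bounded_linear_Blinfun_apply bl[simplified])
  qed
  have "((\<lambda>x. integral (cbox 0 1) (\<lambda>\<tau>. cross2 (v (?q x \<tau>)) (x - p)))
      has_derivative integral (cbox 0 1) (\<lambda>\<tau>. Blinfun (g x \<tau>))) (at x within ball p 1)"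
  proof (rule leibniz_rule[OF dg _ cg x convex_ball])
    fix x assume x: "x \<in> ball p 1"
    have "continuous_on {0..1} (\<lambda>\<tau>. v (?q x \<tau>))"
      by (rule continuous_on_compose2[OF continuous_on_f]) (use q[OF x] in \<open>auto intro!: continuous_intros\<close>)
    then show "(\<lambda>\<tau>. cross2 (v (?q x \<tau>)) (x - p)) integrable_on cbox 0 1"
      by (intro integrable_continuous continuous_intros) simp
  qed
  moreover have "blinfun_apply (integral (cbox 0 1) (\<lambda>\<tau>. Blinfun (g x \<tau>))) = cross2 (v x)"
  proof
    fix h
    have "continuous_on (cbox 0 (1::real)) (\<lambda>\<tau>. (x, \<tau>))" by (intro continuous_intros)
    from continuous_on_compose2[OF cg this]
    have "continuous_on (cbox 0 1) (\<lambda>\<tau>. Blinfun (g x \<tau>))"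
      using x by (simp add: image_subset_iff)
    then have int: "(\<lambda>\<tau>. Blinfun (g x \<tau>)) integrable_on cbox 0 1" by (rule integrable_continuous)
    have "integral (cbox 0 1) (\<lambda>\<tau>. Blinfun (g x \<tau>)) h = integral (cbox 0 1) (\<lambda>\<tau>. Blinfun (g x \<tau>) h)"
      using integral_linear[OF int blinfun.bounded_linear_left, of h] by (simp add: o_def)
    also have "\<dots> = integral {0..1} (\<lambda>\<tau>. g x \<tau> h)"
      unfolding box_real by (rule integral_cong) (simp add: bounded_linear_Blinfun_apply[OF bl[OF x]])
    also have "\<dots> = cross2 (v x) h" using ig by (rule integral_unique)
    finally show "integral (cbox 0 1) (\<lambda>\<tau>. Blinfun (g x \<tau>)) h = cross2 (v x) h" .
  qed
  ultimately show ?thesis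
    unfolding stream_def[abs_def] by (simp only: box_real at_within_open[OF x open_ball])
qed

end

section \<open>Closed level curves of the stream function and injectivity of trajectories\<close>

context divergence_free_field
begin

lemma ball_subset_U: "ball p 1 \<subseteq> U"
  using ball_subset_cball disc by blast

lemma stream_along:
  assumes X: "u \<in> S" "X u \<in> ball p 1" "(X has_vector_derivative w) (at u within S)"
  shows "((\<lambda>u. stream (X u)) has_real_derivative cross2 (v (X u)) w) (at u within S)"
proof -
  interpret c: bounded_bilinear cross2 by (rule bounded_bilinear_cross2)
  have "((\<lambda>u. stream (X u)) has_derivative (\<lambda>h. cross2 (v (X u)) (h *\<^sub>R w))) (at u within S)"
    by (rule has_derivative_compose[OF X(3)[unfolded has_vector_derivative_def] has_derivative_stream[OF X(2)]])
  then show ?thesis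
    unfolding has_field_derivative_def
    by (rule has_derivative_eq_rhs) (simp add: c.scaleR_right mult.commute fun_eq_iff)
qed

lemma stream_of_solution:
  assumes X: "\<And>t. t \<in> {0..T} \<Longrightarrow> X t \<in> ball p 1"
      "\<And>t. t \<in> {0..T} \<Longrightarrow> (X has_vector_derivative v (X t)) (at t within {0..T})"
    and t: "t \<in> {0..T}"
  shows "stream (X t) = stream (X 0)"
proof -
  have "((\<lambda>u. stream (X u)) has_real_derivative 0) (at x within {0..T})" if "x \<in> {0..T}" for x
    using stream_along[where X = X, OF that X(1)[OF that] X(2)[OF that]] by simp
  then have "\<exists>c. \<forall>t\<in>{0..T}. stream (X t) = c"
    by (intro has_field_derivative_zero_constant convex_real_interval) auto
  then show ?thesis using t by force
qed

text \<open>At an extremum the differential \<open>cross2 (v x)\<close> would vanish, but the area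
  form is nondegenerate.\<close>

lemma stream_no_local_extremum:
  assumes "open S" "x \<in> S" "x \<in> ball p 1" "v x \<noteq> 0"
  shows "\<not> ((\<forall>y\<in>S. stream y \<le> stream x) \<or> (\<forall>y\<in>S. stream x \<le> stream y))"
proof
  assume *: "(\<forall>y\<in>S. stream y \<le> stream x) \<or> (\<forall>y\<in>S. stream x \<le> stream y)"
  have "cross2 (v x) = (\<lambda>h. 0)"
    by (rule differential_zero_maxmin[OF assms(2,1) has_derivative_stream[OF assms(3)] *])
  then show False using cross2_nondegenerate[of "v x"] assms(4) by simp
qed

text \<open>On the closure of the region enclosed by the loop, \<open>stream\<close> attains a
  maximum and a minimum. If one of them lies inside, it is critical; if both lie on the loop,
  \<open>stream\<close> is constant inside and every interior point is critical. Either way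
  \<open>v\<close> would vanish in the disc.\<close>

lemma no_stream_level_loop:
  assumes c: "simple_path c" "pathfinish c = pathstart c"
    and c_disc: "\<And>u. u \<in> {0..1} \<Longrightarrow> c u \<in> ball p 1"
    and const: "\<And>u. u \<in> {0..1} \<Longrightarrow> stream (c u) = k"
    and nz: "\<And>x. x \<in> ball p 1 \<Longrightarrow> v x \<noteq> 0"
  shows False
proof -
  \<comment> \<open>\<open>h\<close> and \<open>h'\<close> are mutually inverse isometries between
    the plane and the complex numbers, where the Jordan curve theorem is applied.\<close>
  define h where "h = (\<lambda>x :: real ^ 2. Complex (x $ 1) (x $ 2))"
  define h' where "h' = (\<lambda>z. (\<chi> i. if i = 1 then Re z else Im z) :: real ^ 2)"
  have h'h [simp]: "h' (h x) = x" for x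
    by (simp add: h_def h'_def vec_eq_iff forall_2)
  have hh' [simp]: "h (h' z) = z" for z
    by (simp add: h_def h'_def)
  have h_eq: "h x = h y \<longleftrightarrow> x = y" for x y
    using h'h by metis
  have ch: "continuous_on S h" for S
    unfolding h_def Complex_eq by (intro continuous_intros)
  have ch': "continuous_on S h'" for S
    unfolding h'_def
  proof (rule continuous_on_vec_lambda)
    show "continuous_on S (\<lambda>z. if i = 1 then Re z else Im z)" for i :: 2
      by (cases "i = 1") (auto intro!: continuous_intros)
  qed
  have dist_h: "dist (h x) (h y) = dist x y" for x y
    by (simp add: h_def dist_norm norm_eq_sqrt_inner[of "x - y"] inner_vec_def sum_2 cmod_def power2_eq_square)
  let ?g = "h \<circ> c"
  define W where "W = inside (path_image ?g)"
  have "path ?g"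
    using c(1) unfolding simple_path_def path_def by (intro continuous_on_compose ch) auto
  moreover have "loop_free ?g"
    using c(1) unfolding simple_path_def loop_free_def by (simp add: h_eq)
  ultimately have "simple_path ?g" by (simp add: simple_path_def)
  moreover have "pathfinish ?g = pathstart ?g"
    using c(2) by (simp add: pathfinish_def pathstart_def)
  ultimately have W: "W \<noteq> {}" "open W" "bounded W" "frontier W = path_image ?g"
    using Jordan_inside_outside[of ?g] unfolding W_def by auto
  have g_ball: "path_image ?g \<subseteq> ball (h p) 1"
    using c_disc by (auto simp: path_image_def dist_h)
  \<comment> \<open>A convex set containing the loop contains all that the loop encloses, so the
    enclosed region stays where \<open>stream\<close> is differentiable.\<close>
  have "- ball (h p) 1 \<subseteq> outside (path_image ?g)"
    by (rule outside_subset_convex[OF convex_ball g_ball])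
  then have W_ball: "W \<subseteq> ball (h p) 1"
    using inside_Int_outside[of "path_image ?g"] unfolding W_def by blast
  have cl: "closure W = W \<union> path_image ?g"
    using W(4) by (metis closure_Un_frontier)
  have cl_ball: "h' z \<in> ball p 1" if "z \<in> closure W" for z
  proof -
    have "h (h' z) \<in> ball (h p) 1" using that cl W_ball g_ball by auto
    then show ?thesis by (simp only: mem_ball dist_h)
  qed
  have "continuous_on (ball p 1) stream"
    by (rule has_derivative_continuous_on, rule has_derivative_at_withinI, rule has_derivative_stream)
  then have cs: "continuous_on (closure W) (\<lambda>z. stream (h' z))"
    by (rule continuous_on_compose2[OF _ ch']) (use cl_ball in auto)
  have W_compact: "compact (closure W)" "closure W \<noteq> {}"
    using W(1,3) by (auto simp: compact_closure)
  obtain z1 where z1: "z1 \<in> closure W" "\<And>z. z \<in> closure W \<Longrightarrow> stream (h' z) \<le> stream (h' z1)"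
    using continuous_attains_sup[OF W_compact cs] by blast
  obtain z2 where z2: "z2 \<in> closure W" "\<And>z. z \<in> closure W \<Longrightarrow> stream (h' z2) \<le> stream (h' z)"
    using continuous_attains_inf[OF W_compact cs] by blast
  have frontier_const: "stream (h' z) = k" if "z \<in> path_image ?g" for z
    using that const by (auto simp: path_image_def)
  have W_closure: "W \<subseteq> closure W" by (rule closure_subset)
  have no_ext: False
    if z: "z \<in> W" and ext: "(\<forall>y\<in>W. stream (h' y) \<le> stream (h' z)) \<or> (\<forall>y\<in>W. stream (h' z) \<le> stream (h' y))" for z
  proof -
    have "open (h -` W)"
      using continuous_on_open_vimage[OF open_UNIV, of h] ch W(2) by auto
    moreover have "h' z \<in> h -` W" using z by simp
    moreover have "h' z \<in> ball p 1" using cl_ball W_closure z by auto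
    ultimately have "\<not> ((\<forall>y\<in>h -` W. stream y \<le> stream (h' z)) \<or> (\<forall>y\<in>h -` W. stream (h' z) \<le> stream y))"
      using nz by (intro stream_no_local_extremum) auto
    moreover have "(\<forall>y\<in>h -` W. stream y \<le> stream (h' z)) \<or> (\<forall>y\<in>h -` W. stream (h' z) \<le> stream y)"
      using ext by (metis h'h vimageE)
    ultimately show False by blast
  qed
  obtain z0 where z0: "z0 \<in> W" using W(1) by blast
  consider "z1 \<in> W" | "z2 \<in> W" | "z1 \<in> path_image ?g" "z2 \<in> path_image ?g"
    using z1(1) z2(1) cl by blast
  then show False
  proof cases
    case 1 then show False using no_ext[of z1] z1(2) W_closure by blast
  next
    case 2 then show False using no_ext[of z2] z2(2) W_closure by blast
  next
    case 3
    then have "stream (h' z) = k" if "z \<in> W" for z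
      using z1(2)[of z] z2(2)[of z] frontier_const W_closure that by fastforce
    then show False using no_ext[OF z0] z0 by simp
  qed
qed

text \<open>If \<open>X a = X b\<close>, Rolle's theorem for the component along the velocity at
  \<open>a\<close> yields an intermediate velocity orthogonal to it. On a short interval this is
  impossible: the velocity varies by less than \<open>m\<close>, while its length is at least
  \<open>m\<close>. The gap \<open>d\<close> later makes the set of return pairs compact.\<close>

lemma solution_locally_inj:
  assumes X: "\<And>u. u \<in> {0..T} \<Longrightarrow> X u \<in> ball p 1"
      "\<And>u. u \<in> {0..T} \<Longrightarrow> (X has_vector_derivative v (X u)) (at u within {0..T})"
    and nz: "0 < m" "\<And>x. x \<in> ball p 1 \<Longrightarrow> m \<le> norm (v x)"
  obtains d where "0 < d" "\<And>a b. 0 \<le> a \<Longrightarrow> a < b \<Longrightarrow> b \<le> T \<Longrightarrow> b - a < d \<Longrightarrow> X a \<noteq> X b"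
proof -
  have "continuous_on {0..T} X"
    using X(2) by (rule continuous_on_vector_derivative)
  then have "continuous_on {0..T} (\<lambda>u. v (X u))"
    by (rule continuous_on_compose2[OF continuous_on_f]) (use X(1) ball_subset_U in blast)
  then have "uniformly_continuous_on {0..T} (\<lambda>u. v (X u))"
    by (rule compact_uniformly_continuous) simp
  then obtain d where d: "0 < d"
    "\<And>x y. x \<in> {0..T} \<Longrightarrow> y \<in> {0..T} \<Longrightarrow> dist y x < d \<Longrightarrow> dist (v (X y)) (v (X x)) < m"
    unfolding uniformly_continuous_on_def using nz(1) by meson
  have "X a \<noteq> X b" if ab: "0 \<le> a" "a < b" "b \<le> T" "b - a < d" for a b
  proof
    assume eq: "X a = X b"
    let ?w = "v (X a)"
    have "\<exists>x\<in>{a<..<b}. ?w \<bullet> X b - ?w \<bullet> X a = (b - a) * (?w \<bullet> v (X x))"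
    proof (rule mvt_simple[OF \<open>a < b\<close>])
      fix x assume "a \<le> x" "x \<le> b"
      then have "(X has_vector_derivative v (X x)) (at x within {a..b})"
        using ab by (intro has_vector_derivative_within_subset[OF X(2)]) auto
      from has_derivative_inner_right[OF this[unfolded has_vector_derivative_def], of ?w]
      show "((\<lambda>u. ?w \<bullet> X u) has_derivative (\<lambda>h. h * (?w \<bullet> v (X x)))) (at x within {a..b})"
        by simp
    qed
    then obtain x where x: "a < x" "x < b" "?w \<bullet> v (X x) = 0"
      using eq ab by auto
    have "norm (v (X x) - ?w) < m"
      using d(2)[of a x] x ab by (auto simp: dist_norm)
    also have "m \<le> norm ?w" using nz(2) X(1)[of a] ab by simp
    finally have lt: "norm (v (X x) - ?w) < norm ?w" .
    then have "norm ?w > 0" using norm_ge_zero le_less_trans by blast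
    have "(norm ?w)\<^sup>2 = ?w \<bullet> (?w - v (X x))"
      using x(3) by (simp add: inner_diff_right power2_norm_eq_inner)
    also have "\<dots> \<le> norm ?w * norm (v (X x) - ?w)"
      using norm_cauchy_schwarz[of ?w "?w - v (X x)"] by (simp add: norm_minus_commute)
    also have "\<dots> < norm ?w * norm ?w"
      using lt \<open>norm ?w > 0\<close> by simp
    finally show False by (simp add: power2_eq_square)
  qed
  with d(1) show ?thesis by (rule that)
qed

text \<open>Among all pairs of times at which the curve returns to the same point, one at minimal
  distance cuts out a simple loop.\<close>

lemma solution_inj:
  assumes X: "\<And>u. u \<in> {0..T} \<Longrightarrow> X u \<in> ball p 1"
      "\<And>u. u \<in> {0..T} \<Longrightarrow> (X has_vector_derivative v (X u)) (at u within {0..T})"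
    and nz: "0 < m" "\<And>x. x \<in> ball p 1 \<Longrightarrow> m \<le> norm (v x)"
  shows "inj_on X {0..T}"
proof (rule ccontr)
  assume "\<not> inj_on X {0..T}"
  then obtain a0 b0 where ab0: "a0 \<in> {0..T}" "b0 \<in> {0..T}" "a0 < b0" "X a0 = X b0"
    unfolding inj_on_def by (metis linorder_neqE_linordered_idom)
  obtain d where d: "0 < d" "\<And>a b. 0 \<le> a \<Longrightarrow> a < b \<Longrightarrow> b \<le> T \<Longrightarrow> b - a < d \<Longrightarrow> X a \<noteq> X b"
    using solution_locally_inj[OF X nz] by blast
  have cX: "continuous_on {0..T} X"
    using X(2) by (rule continuous_on_vector_derivative)
  \<comment> \<open>By the choice of \<open>d\<close>, the condition
    \<open>fst z + d \<le> snd z\<close> loses no return pair compared with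
    \<open>fst z < snd z\<close>, and it makes \<open>K\<close> closed.\<close>
  define K where "K = {z \<in> {0..T} \<times> {0..T}. X (fst z) - X (snd z) = 0} \<inter> {z. fst z + d \<le> snd z}"
  have "continuous_on ({0..T} \<times> {0..T}) (\<lambda>z. X (fst z) - X (snd z))"
    by (intro continuous_intros continuous_on_compose2[OF cX]) auto
  then have "closed {z \<in> {0..T} \<times> {0..T}. X (fst z) - X (snd z) = 0}"
    by (rule continuous_closed_preimage_constant) (intro closed_Times closed_atLeastAtMost)
  moreover have "closed {z::real\<times>real. fst z + d \<le> snd z}"
    by (intro closed_Collect_le continuous_intros)
  ultimately have "closed K" unfolding K_def by (rule closed_Int)
  moreover have "bounded K"
    by (rule bounded_subset[of "{0..T} \<times> {0..T}"]) (auto simp: K_def intro: bounded_Times)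
  ultimately have "compact K" by (simp add: compact_eq_bounded_closed)
  moreover have "(a0, b0) \<in> K"
    using ab0 d(2)[of a0 b0] by (fastforce simp: K_def)
  moreover have "continuous_on K (\<lambda>z. snd z - fst z)" by (intro continuous_intros)
  ultimately obtain z where z: "z \<in> K" "\<And>y. y \<in> K \<Longrightarrow> snd z - fst z \<le> snd y - fst y"
    using continuous_attains_inf[of K "\<lambda>z. snd z - fst z"] by blast
  define a b where "a = fst z" and "b = snd z"
  have ab: "0 \<le> a" "a + d \<le> b" "b \<le> T" "X a = X b"
    using z(1) by (auto simp: K_def a_def b_def)
  have min: "b - a \<le> y - x" if "0 \<le> x" "x < y" "y \<le> T" "X x = X y" for x y
    using z(2)[of "(x, y)"] that d(2)[of x y] by (fastforce simp: K_def a_def b_def)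
  define s where "s = (\<lambda>u. a + u * (b - a))"
  have s: "s u \<in> {0..T}" if "u \<in> {0..1}" for u
  proof -
    have "u * (b - a) \<le> 1 * (b - a)" "0 \<le> u * (b - a)"
      using that ab d(1) by (auto intro!: mult_right_mono)
    then show ?thesis using ab unfolding s_def by auto
  qed
  \<comment> \<open>Any coincidence other than that of the two endpoints would give a return faster
    than the minimal \<open>b - a\<close>.\<close>
  have loop: "x = 0 \<and> y = 1" if xy: "x \<in> {0..1}" "y \<in> {0..1}" "x < y" "X (s x) = X (s y)" for x y
  proof -
    have "s x < s y" using xy ab d(1) by (simp add: s_def)
    then have "b - a \<le> s y - s x"
      using min[of "s x" "s y"] s[OF xy(1)] s[OF xy(2)] xy(4) by auto
    also have "\<dots> = (y - x) * (b - a)" by (simp add: s_def algebra_simps)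
    finally have "1 \<le> y - x" using ab d(1) by (simp add: mult_le_cancel_right1)
    then show ?thesis using xy by auto
  qed
  show False
  proof (rule no_stream_level_loop[of "\<lambda>u. X (s u)" "stream (X 0)"])
    have "continuous_on {0..1} (\<lambda>u. X (s u))"
      by (rule continuous_on_compose2[OF cX]) (use s in \<open>auto simp: s_def intro!: continuous_intros\<close>)
    moreover have "loop_free (\<lambda>u. X (s u))"
      unfolding loop_free_def using loop by (metis linorder_neqE_linordered_idom)
    ultimately show "simple_path (\<lambda>u. X (s u))" by (simp add: simple_path_def path_def)
    show "pathfinish (\<lambda>u. X (s u)) = pathstart (\<lambda>u. X (s u))"
      using ab by (simp add: pathfinish_def pathstart_def s_def)
    show "X (s u) \<in> ball p 1" if "u \<in> {0..1}" for u using X(1) s that by blast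
    show "stream (X (s u)) = stream (X 0)" if "u \<in> {0..1}" for u
      using stream_of_solution[OF X s[OF that]] .
    show "v x \<noteq> 0" if "x \<in> ball p 1" for x using nz(1) nz(2)[OF that] by auto
  qed
qed

end

section \<open>Differentiability in the initial value\<close>

lemma speed_bound:
  fixes X :: "real \<Rightarrow> 'a::real_normed_vector"
  assumes der: "\<And>u. u \<in> {0..T} \<Longrightarrow> (X has_vector_derivative g u) (at u within {0..T})"
    and bnd: "\<And>u. u \<in> {0..T} \<Longrightarrow> norm (g u) \<le> M"
    and ab: "a \<in> {0..T}" "b \<in> {0..T}"
  shows "norm (X a - X b) \<le> M * \<bar>a - b\<bar>"
proof -
  have "norm (X a - X b) \<le> M * norm (a - b)"
  proof (rule differentiable_bound[OF convex_real_interval(5) _ _ ab])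
    show "(X has_derivative (\<lambda>h. h *\<^sub>R g u)) (at u within {0..T})" if "u \<in> {0..T}" for u
      using der[OF that] by (simp add: has_vector_derivative_def)
    show "onorm (\<lambda>h. h *\<^sub>R g u) \<le> M" if "u \<in> {0..T}" for u
      by (rule onorm_le) (use bnd[OF that] in \<open>simp add: mult.commute[of M] mult_left_mono\<close>)
  qed
  then show ?thesis by simp
qed

lemma variational_solution_exists:
  fixes v :: "'a::euclidean_space \<Rightarrow> 'a"
  assumes "C1_field U v D" "K \<subseteq> U" "0 \<le> T"
    and lip: "L-lipschitz_on K v" "\<And>x h. x \<in> K \<Longrightarrow> norm (D x h) \<le> L * norm h"
    and X: "continuous_on {0..T} X" "\<And>u. u \<in> {0..T} \<Longrightarrow> X u \<in> K"
  obtains w where "w 0 = w0"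
    "\<And>t. t \<in> {0..T} \<Longrightarrow> (w has_vector_derivative D (X t) (w t)) (at t within {0..T})"
proof -
  interpret C1_field U v D by fact
  have XU: "X u \<in> U" if "u \<in> {0..T}" for u using X(2)[OF that] assms(2) by blast
  have lin: "linear (D (X u))" if "u \<in> {0..T}" for u
    using has_derivative_linear[OF der[OF XU[OF that]]] .
  show ?thesis
  proof (rule picard_lindelof_exists[OF \<open>0 \<le> T\<close> lipschitz_on_nonneg[OF lip(1)], of "\<lambda>t. D (X t)" w0])
    fix w :: "real \<Rightarrow> 'a" assume w: "continuous_on {0..T} w"
    have "continuous_on {0..T} (\<lambda>t. D (X t) b)" for b
      by (rule continuous_on_compose2[OF cont X(1)]) (use XU in blast)
    \<comment> \<open>Continuity of \<open>D\<close> is known for fixed directions, so the varying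
      argument \<open>w t\<close> is expanded in the basis.\<close>
    then have "continuous_on {0..T} (\<lambda>t. \<Sum>b\<in>Basis. (w t \<bullet> b) *\<^sub>R D (X t) b)"
      by (intro continuous_intros w)
    moreover have "(\<Sum>b\<in>Basis. (w t \<bullet> b) *\<^sub>R D (X t) b) = D (X t) (w t)" if "t \<in> {0..T}" for t
    proof -
      have "D (X t) (w t) = D (X t) (\<Sum>b\<in>Basis. (w t \<bullet> b) *\<^sub>R b)"
        by (simp add: euclidean_representation)
      then show ?thesis
        by (simp only: linear_sum[OF lin[OF that]] linear_cmul[OF lin[OF that]])
    qed
    ultimately show "continuous_on {0..T} (\<lambda>t. D (X t) (w t))"
      by (rule continuous_on_eq)
  next
    fix t x y assume "t \<in> {0..T}"
    then show "norm (D (X t) x - D (X t) y) \<le> L * norm (x - y)"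
      using lip(2)[OF X(2), of t "x - y"] linear_diff[OF lin, of t x y] by simp
  qed (rule that)
qed

text \<open>The error z = X s' - X s - (s' - s) w satisfies the linear equation z' = D z up to the
  Taylor remainder of \<open>v\<close>. That remainder is small compared with |X s' - X s|, which is
  at most a multiple of |s' - s|, so Gronwall's inequality bounds z.\<close>

lemma solution_differentiable_in_parameter:
  fixes v :: "'a::euclidean_space \<Rightarrow> 'a"
  assumes C1: "C1_field U v D" and K: "compact K" "convex K" "K \<subseteq> U"
    and lip: "L-lipschitz_on K v" "\<And>x h. x \<in> K \<Longrightarrow> norm (D x h) \<le> L * norm h"
    and X: "\<And>s t. s \<in> I \<Longrightarrow> t \<in> {0..T} \<Longrightarrow> X s t \<in> K"
      "\<And>s t. s \<in> I \<Longrightarrow> t \<in> {0..T} \<Longrightarrow> (X s has_vector_derivative v (X s t)) (at t within {0..T})"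
    and init: "((\<lambda>s. X s 0) has_vector_derivative w 0) (at s within I)" "s \<in> I"
    and w: "\<And>t. t \<in> {0..T} \<Longrightarrow> (w has_vector_derivative D (X s t) (w t)) (at t within {0..T})"
    and "0 < e"
  obtains d where "0 < d"
    "\<And>s' t. s' \<in> I \<Longrightarrow> \<bar>s' - s\<bar> < d \<Longrightarrow> t \<in> {0..T} \<Longrightarrow>
      norm (X s' t - X s t - (s' - s) *\<^sub>R w t) \<le> e * \<bar>s' - s\<bar>"
proof -
  interpret C1_field U v D by fact
  \<comment> \<open>\<open>E\<close> is the Gronwall factor, and
    \<open>N * \<bar>s' - s\<bar>\<close> will bound the initial difference, thanks to
    \<open>e1 \<le> 1\<close>. With \<open>e1\<close> and \<open>\<eta>\<close> chosen as below, the
    initial error and the Taylor remainder each contribute at most \<open>e / 2\<close> after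
    multiplication by \<open>E\<close>.\<close>
  define E where "E = exp ((L + 1) * T)"
  define N where "N = norm (w 0) + 1"
  define e1 where "e1 = min 1 (e / (2 * E))"
  define \<eta> where "\<eta> = e / (2 * E * E * N)"
  have pos: "E > 0" "N > 0" "e1 > 0" "\<eta> > 0"
    using \<open>0 < e\<close> by (auto simp: E_def N_def e1_def \<eta>_def add_nonneg_pos)
  obtain d1 where d1: "d1 > 0"
    "\<And>s'. s' \<in> I \<Longrightarrow> \<bar>s' - s\<bar> < d1 \<Longrightarrow> norm (X s' 0 - X s 0 - (s' - s) *\<^sub>R w 0) \<le> e1 * \<bar>s' - s\<bar>"
    using init(1)[unfolded has_vector_derivative_def has_derivative_within_alt] pos(3)
    by (metis real_norm_def)
  obtain d2 where d2: "d2 > 0" "\<And>x y. x \<in> K \<Longrightarrow> y \<in> K \<Longrightarrow> norm (y - x) < d2 \<Longrightarrow>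
      norm (v y - v x - D x (y - x)) \<le> \<eta> * norm (y - x)"
    using uniformly_differentiable[OF K(1,3,2) pos(4)] by blast
  define d where "d = min d1 (d2 / (E * N))"
  have "norm (X s' t - X s t - (s' - s) *\<^sub>R w t) \<le> e * \<bar>s' - s\<bar>"
    if s': "s' \<in> I" "\<bar>s' - s\<bar> < d" and t: "t \<in> {0..T}" for s' t
  proof -
    have init': "norm (X s' 0 - X s 0 - (s' - s) *\<^sub>R w 0) \<le> e1 * \<bar>s' - s\<bar>"
      using d1(2)[OF s'(1)] s'(2) by (simp add: d_def)
    also have "\<dots> \<le> 1 * \<bar>s' - s\<bar>" by (intro mult_right_mono) (auto simp: e1_def)
    finally have "norm (X s' 0 - X s 0) \<le> N * \<bar>s' - s\<bar>"
      using norm_triangle_sub[of "X s' 0 - X s 0" "(s' - s) *\<^sub>R w 0"]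
      by (simp add: N_def distrib_right mult.commute[of "norm (w 0)"])
    then have "E * norm (X s' 0 - X s 0) \<le> E * N * \<bar>s' - s\<bar>"
      using pos(1) by simp
    then have close: "norm (X s' \<tau> - X s \<tau>) \<le> E * N * \<bar>s' - s\<bar>" if "\<tau> \<in> {0..T}" for \<tau>
      using lipschitz_solutions_agree[OF lip(1) X[OF init(2)] X[OF s'(1)] that]
      unfolding E_def by linarith
    have "E * N * \<bar>s' - s\<bar> < d2"
      using s'(2) pos by (simp add: d_def field_simps)
    with close have close': "norm (X s' \<tau> - X s \<tau>) < d2" if "\<tau> \<in> {0..T}" for \<tau>
      using that by fastforce
    have "norm (X s' t - X s t - (s' - s) *\<^sub>R w t) \<le>
        exp ((L + 1) * T) * (norm (X s' 0 - X s 0 - (s' - s) *\<^sub>R w 0) + \<eta> * (E * N * \<bar>s' - s\<bar>))"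
    proof (rule gronwall_norm[where g = "\<lambda>\<tau>. v (X s' \<tau>) - v (X s \<tau>) - (s' - s) *\<^sub>R D (X s \<tau>) (w \<tau>)"])
      fix \<tau> assume \<tau>: "\<tau> \<in> {0..T}"
      let ?x = "X s \<tau>" and ?y = "X s' \<tau>"
      show "((\<lambda>\<tau>. X s' \<tau> - X s \<tau> - (s' - s) *\<^sub>R w \<tau>) has_vector_derivative
          v ?y - v ?x - (s' - s) *\<^sub>R D ?x (w \<tau>)) (at \<tau> within {0..T})"
        by (intro has_vector_derivative_diff X(2)[OF s'(1) \<tau>] X(2)[OF init(2) \<tau>]
            bounded_linear.has_vector_derivative[OF bounded_linear_scaleR_right] w[OF \<tau>])
      have xy: "?x \<in> K" "?y \<in> K" using X(1)[OF _ \<tau>] s'(1) init(2) by auto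
      have lin: "linear (D ?x)"
        using has_derivative_linear[OF der] xy(1) K(3) by blast
      have "v ?y - v ?x - (s' - s) *\<^sub>R D ?x (w \<tau>) =
          (v ?y - v ?x - D ?x (?y - ?x)) + D ?x (?y - ?x - (s' - s) *\<^sub>R w \<tau>)"
        by (simp add: linear_diff[OF lin] linear_cmul[OF lin])
      also have "norm \<dots> \<le> \<eta> * norm (?y - ?x) + L * norm (?y - ?x - (s' - s) *\<^sub>R w \<tau>)"
        by (intro norm_triangle_mono d2(2) lip(2) xy close' \<tau>)
      also have "\<dots> \<le> \<eta> * (E * N * \<bar>s' - s\<bar>) + L * norm (?y - ?x - (s' - s) *\<^sub>R w \<tau>)"
        using mult_left_mono[OF close[OF \<tau>], of \<eta>] pos(4) by simp
      finally show "norm (v ?y - v ?x - (s' - s) *\<^sub>R D ?x (w \<tau>))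
          \<le> L * norm (?y - ?x - (s' - s) *\<^sub>R w \<tau>) + \<eta> * (E * N * \<bar>s' - s\<bar>)"
        by simp
    qed (use t pos lipschitz_on_nonneg[OF lip(1)] in auto)
    also have "\<dots> \<le> E * (e / (2 * E) * \<bar>s' - s\<bar> + \<eta> * (E * N * \<bar>s' - s\<bar>))"
    proof -
      have "e1 * \<bar>s' - s\<bar> \<le> e / (2 * E) * \<bar>s' - s\<bar>"
        by (intro mult_right_mono) (auto simp: e1_def)
      then show ?thesis unfolding E_def[symmetric] using init' pos(1) by (intro mult_left_mono) auto
    qed
    also have "\<dots> = e * \<bar>s' - s\<bar>"
      using pos by (simp add: \<eta>_def field_simps)
    finally show ?thesis .
  qed
  moreover have "d > 0" using d1(1) d2(1) pos by (simp add: d_def)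
  ultimately show ?thesis using that by blast
qed

text \<open>The increment splits into a move in time along the trajectory of \<open>s'\<close>, the
  exchange of its velocity at \<open>t\<close> for that of \<open>s\<close>, and a move in s at the
  fixed time \<open>t\<close>. In this order the parameter derivative is needed only at
  \<open>t\<close>, and the move in time is controlled uniformly in \<open>s'\<close> by the
  Lipschitz bound.\<close>

lemma solution_jointly_differentiable:
  fixes v :: "'a::euclidean_space \<Rightarrow> 'a" and X :: "real \<Rightarrow> real \<Rightarrow> 'a"
  assumes C1: "C1_field U v D" and K: "compact K" "convex K" "K \<subseteq> U"
    and lip: "L-lipschitz_on K v" "\<And>x h. x \<in> K \<Longrightarrow> norm (D x h) \<le> L * norm h"
    and X: "\<And>s t. s \<in> I \<Longrightarrow> t \<in> {0..T} \<Longrightarrow> X s t \<in> K"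
      "\<And>s t. s \<in> I \<Longrightarrow> t \<in> {0..T} \<Longrightarrow> (X s has_vector_derivative v (X s t)) (at t within {0..T})"
    and init: "((\<lambda>s. X s 0) has_vector_derivative w 0) (at s within I)" "s \<in> I"
    and w: "\<And>t. t \<in> {0..T} \<Longrightarrow> (w has_vector_derivative D (X s t) (w t)) (at t within {0..T})"
    and t: "t \<in> {0..T}"
  shows "((\<lambda>z. X (fst z) (snd z)) has_derivative (\<lambda>h. fst h *\<^sub>R w t + snd h *\<^sub>R v (X s t)))
    (at (s, t) within I \<times> {0..T})"
proof -
  interpret C1_field U v D by fact
  have L: "0 \<le> L" using lipschitz_on_nonneg[OF lip(1)] .
  obtain M where M: "M > 0" "\<And>x. x \<in> K \<Longrightarrow> norm (v x) \<le> M"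
    using compact_imp_bounded[OF compact_continuous_image[OF lipschitz_on_continuous_on[OF lip(1)] K(1)]]
    unfolding bounded_pos by auto
  show ?thesis
    unfolding has_derivative_within_alt
  proof (intro conjI allI impI)
    show "bounded_linear (\<lambda>h. fst h *\<^sub>R w t + snd h *\<^sub>R v (X s t))"
      by (intro bounded_linear_add bounded_linear_scaleR_left[THEN bounded_linear_compose]
          bounded_linear_fst bounded_linear_snd)
    fix e :: real assume e: "0 < e"
    then have e4: "e / 4 > 0" by simp
    obtain d1 where d1: "d1 > 0" "\<And>s' t. s' \<in> I \<Longrightarrow> \<bar>s' - s\<bar> < d1 \<Longrightarrow> t \<in> {0..T} \<Longrightarrow>
        norm (X s' t - X s t - (s' - s) *\<^sub>R w t) \<le> e / 4 * \<bar>s' - s\<bar>"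
      using solution_differentiable_in_parameter[OF C1 K lip X init w e4] by blast
    \<comment> \<open>\<open>B\<close> is a Lipschitz constant at \<open>s\<close> for s' \<mapsto>
      X s' t, and \<open>M\<close> bounds the speed. The choice of \<open>d\<close> makes each of
      the three errors at most \<open>e / 4\<close> times the increment; \<open>L + 1\<close> keeps
      the denominators positive when \<open>L = 0\<close>.\<close>
    define B where "B = norm (w t) + e / 4"
    have B: "B > 0" using e4 by (simp add: B_def add_nonneg_pos)
    define d where "d = Min {d1, e / (4 * ((L + 1) * M)), e / (4 * ((L + 1) * B))}"
    have d: "d > 0" "d \<le> d1" "d \<le> e / (4 * ((L + 1) * M))" "d \<le> e / (4 * ((L + 1) * B))"
      using e L M(1) B d1(1) by (auto simp: d_def)
    have "0 < 4 * ((L + 1) * M)" "0 < 4 * ((L + 1) * B)" using L M(1) B by auto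
    then have dM: "d * (4 * ((L + 1) * M)) \<le> e" and dB: "d * (4 * ((L + 1) * B)) \<le> e"
      using d(3,4) by (simp_all only: pos_le_divide_eq)
    have "norm (X s' t' - X s t - ((s' - s) *\<^sub>R w t + (t' - t) *\<^sub>R v (X s t))) \<le> e * norm ((s', t') - (s, t))"
      if st: "s' \<in> I" "t' \<in> {0..T}" and near: "norm ((s', t') - (s, t)) < d" for s' t'
    proof -
      have coord: "\<bar>s' - s\<bar> \<le> norm ((s', t') - (s, t))" "\<bar>t' - t\<bar> \<le> norm ((s', t') - (s, t))"
        using norm_fst_le[of "s' - s" "t' - t"] norm_snd_le[of "t' - t" "s' - s"] by auto
      then have ds: "\<bar>s' - s\<bar> < d" and dt: "\<bar>t' - t\<bar> < d" using near by linarith+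
      have 1: "norm (X s' t - X s t - (s' - s) *\<^sub>R w t) \<le> e / 4 * \<bar>s' - s\<bar>"
        using d1(2)[OF st(1) _ t] ds d(2) by simp
      have "norm (X s' t - X s t) \<le> B * \<bar>s' - s\<bar>"
        using norm_triangle_sub[of "X s' t - X s t" "(s' - s) *\<^sub>R w t"] 1
        by (simp add: B_def distrib_right mult.commute[of "norm (w t)"])
      then have "norm (v (X s' t) - v (X s t)) \<le> L * (B * \<bar>s' - s\<bar>)"
        using lipschitz_onD[OF lip(1) X(1)[OF st(1) t] X(1)[OF init(2) t]] L
        by (smt (verit) dist_norm mult_left_mono)
      also have "\<dots> \<le> (L + 1) * (B * d)"
        using L B ds by (intro mult_mono) auto
      also have "\<dots> \<le> e / 4"
        using dB by (simp add: algebra_simps)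
      finally have 2: "norm (v (X s' t) - v (X s t)) \<le> e / 4" .
      have "norm (X s' t' - X s' t - (t' - t) *\<^sub>R v (X s' t)) \<le> norm (t' - t) * (e / 4)"
      proof (rule differentiable_bound_linearization[where S = "{0..T} \<inter> cball t \<bar>t' - t\<bar>"
            and f' = "\<lambda>\<tau> h. h *\<^sub>R v (X s' \<tau>)" and ?x0.0 = t and f = "X s'"])
        fix u :: real assume u: "u \<in> {0..1}"
        have "t + u * (t' - t) = (1 - u) * t + u * t'" by (simp add: algebra_simps)
        then have "t + u * (t' - t) \<in> {0..T}"
          using convexD[OF convex_real_interval(5) t st(2), of "1 - u" u] u by simp
        moreover have "\<bar>u * (t' - t)\<bar> \<le> \<bar>t' - t\<bar>" using u by (simp add: abs_mult mult_left_le_one_le)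
        ultimately show "t + u *\<^sub>R (t' - t) \<in> {0..T} \<inter> cball t \<bar>t' - t\<bar>"
          by (simp add: dist_real_def)
      next
        fix \<tau> assume \<tau>: "\<tau> \<in> {0..T} \<inter> cball t \<bar>t' - t\<bar>"
        show "(X s' has_derivative (\<lambda>h. h *\<^sub>R v (X s' \<tau>))) (at \<tau> within {0..T} \<inter> cball t \<bar>t' - t\<bar>)"
          using has_derivative_subset[OF X(2)[OF st(1), unfolded has_vector_derivative_def], of \<tau>] \<tau> by blast
        have "norm (v (X s' \<tau>) - v (X s' t)) \<le> L * norm (X s' \<tau> - X s' t)"
          using lipschitz_onD[OF lip(1) X(1)[OF st(1)] X(1)[OF st(1) t], of \<tau>] \<tau> by (simp add: dist_norm)
        also have "\<dots> \<le> L * (M * \<bar>\<tau> - t\<bar>)"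
          by (intro mult_left_mono speed_bound[OF X(2)[OF st(1)] M(2)[OF X(1)[OF st(1)]]])
            (use \<tau> t L in auto)
        also have "\<dots> \<le> (L + 1) * (M * d)"
          using L M(1) \<tau> dt by (intro mult_mono) (auto simp: dist_real_def)
        also have "\<dots> \<le> e / 4"
          using dM by (simp add: algebra_simps)
        finally have "\<bar>h\<bar> * norm (v (X s' \<tau>) - v (X s' t)) \<le> \<bar>h\<bar> * (e / 4)" for h :: real
          by (rule mult_left_mono) simp
        then show "onorm ((\<lambda>h. h *\<^sub>R v (X s' \<tau>)) - (\<lambda>h. h *\<^sub>R v (X s' t))) \<le> e / 4"
          by (intro onorm_le) (simp add: mult.commute[of e] flip: scaleR_diff_right)
      qed (use t in simp)
      then have 3: "norm (X s' t' - X s' t - (t' - t) *\<^sub>R v (X s' t)) \<le> e / 4 * \<bar>t' - t\<bar>"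
        by (simp add: mult.commute)
      have "X s' t' - X s t - ((s' - s) *\<^sub>R w t + (t' - t) *\<^sub>R v (X s t)) =
          (X s' t' - X s' t - (t' - t) *\<^sub>R v (X s' t)) + (t' - t) *\<^sub>R (v (X s' t) - v (X s t))
          + (X s' t - X s t - (s' - s) *\<^sub>R w t)"
        by (simp add: algebra_simps)
      also have "norm \<dots> \<le> e / 4 * \<bar>t' - t\<bar> + \<bar>t' - t\<bar> * (e / 4) + e / 4 * \<bar>s' - s\<bar>"
        by (intro norm_triangle_mono 1 3) (simp only: norm_scaleR real_norm_def mult_left_mono[OF 2 abs_ge_zero])
      also have "\<dots> \<le> e / 4 * norm ((s', t') - (s, t)) + e / 4 * norm ((s', t') - (s, t)) + e / 4 * norm ((s', t') - (s, t))"
        using coord e4 by (intro add_mono) (auto simp: mult.commute[of _ "e / 4"] intro!: mult_left_mono)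
      also have "\<dots> \<le> e * norm ((s', t') - (s, t))"
        using e by (simp add: field_simps)
      finally show ?thesis .
    qed
    then show "\<exists>d>0. \<forall>y\<in>I \<times> {0..T}. norm (y - (s, t)) < d \<longrightarrow>
        norm (X (fst y) (snd y) - X (fst (s, t)) (snd (s, t)) -
          (fst (y - (s, t)) *\<^sub>R w t + snd (y - (s, t)) *\<^sub>R v (X s t))) \<le> e * norm (y - (s, t))"
      using d(1) by (intro exI[of _ d]) auto
  qed
qed

section \<open>The area swept by a family of trajectories\<close>

context divergence_free_field
begin

text \<open>Liouville's formula with zero trace. The velocity \<open>v (X t)\<close> solves the same
  linear equation as \<open>w\<close>, and a traceless \<open>D\<close> leaves the area spanned by
  two solutions unchanged.\<close>

lemma cross2_variational_constant:
  assumes X: "\<And>t. t \<in> {0..T} \<Longrightarrow> X t \<in> U"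
      "\<And>t. t \<in> {0..T} \<Longrightarrow> (X has_vector_derivative v (X t)) (at t within {0..T})"
    and w: "\<And>t. t \<in> {0..T} \<Longrightarrow> (w has_vector_derivative D (X t) (w t)) (at t within {0..T})"
    and t: "t \<in> {0..T}"
  shows "cross2 (w t) (v (X t)) = cross2 (w 0) (v (X 0))"
proof -
  have "((\<lambda>t. cross2 (w t) (v (X t))) has_real_derivative 0) (at t within {0..T})" if t: "t \<in> {0..T}" for t
  proof -
    have lin: "linear (D (X t))" by (rule linear_D[OF X(1)[OF t]])
    have "((\<lambda>t. v (X t)) has_derivative (\<lambda>h. D (X t) (h *\<^sub>R v (X t)))) (at t within {0..T})"
      by (rule has_derivative_compose[OF X(2)[OF t, unfolded has_vector_derivative_def] der[OF X(1)[OF t]]])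
    then have "((\<lambda>t. v (X t)) has_vector_derivative D (X t) (v (X t))) (at t within {0..T})"
      by (simp add: has_vector_derivative_def linear_cmul[OF lin])
    from bounded_bilinear.has_vector_derivative[OF bounded_bilinear_cross2 w[OF t] this]
    have "((\<lambda>t. cross2 (w t) (v (X t))) has_vector_derivative
        cross2 (w t) (D (X t) (v (X t))) + cross2 (D (X t) (w t)) (v (X t))) (at t within {0..T})" .
    moreover have "cross2 (w t) (D (X t) (v (X t))) + cross2 (D (X t) (w t)) (v (X t)) = 0"
      unfolding cross2_D[OF X(1)[OF t], of "w t"] by (simp add: cross2_def)
    ultimately show ?thesis
      by (simp add: has_real_derivative_iff_has_vector_derivative)
  qed
  then have "\<exists>c. \<forall>t\<in>{0..T}. cross2 (w t) (v (X t)) = c"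
    by (intro has_field_derivative_zero_constant convex_real_interval) auto
  then show ?thesis using t by force
qed

lemma stream_strict_mono_perp:
  assumes \<gamma>: "\<And>s. s \<in> {0..S} \<Longrightarrow> \<gamma> s \<in> ball p 1"
      "\<And>s. s \<in> {0..S} \<Longrightarrow> (\<gamma> has_vector_derivative perp_field v (\<gamma> s)) (at s within {0..S})"
    and nz: "\<And>x. x \<in> ball p 1 \<Longrightarrow> v x \<noteq> 0"
    and ab: "0 \<le> a" "a < b" "b \<le> S"
  shows "stream (\<gamma> a) < stream (\<gamma> b)"
proof -
  have "\<exists>x\<in>{a<..<b}. stream (\<gamma> b) - stream (\<gamma> a) = (norm (v (\<gamma> x)))\<^sup>2 * (b - a)"
  proof (rule mvt_simple[OF \<open>a < b\<close>])
    fix x assume x: "a \<le> x" "x \<le> b"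
    then have xS: "x \<in> {0..S}" using ab by auto
    have "((\<lambda>u. stream (\<gamma> u)) has_real_derivative (norm (v (\<gamma> x)))\<^sup>2) (at x within {0..S})"
      using stream_along[where X = \<gamma>, OF xS \<gamma>(1)[OF xS] \<gamma>(2)[OF xS]] by (simp add: cross2_perp)
    then have "((\<lambda>u. stream (\<gamma> u)) has_real_derivative (norm (v (\<gamma> x)))\<^sup>2) (at x within {a..b})"
      by (rule DERIV_subset) (use ab in auto)
    then show "((\<lambda>u. stream (\<gamma> u)) has_derivative (*) ((norm (v (\<gamma> x)))\<^sup>2)) (at x within {a..b})"
      by (simp add: has_field_derivative_def)
  qed
  then obtain x where x: "a < x" "x < b" "stream (\<gamma> b) - stream (\<gamma> a) = (norm (v (\<gamma> x)))\<^sup>2 * (b - a)"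
    by auto
  have "v (\<gamma> x) \<noteq> 0" using x ab by (intro nz \<gamma>) auto
  then have "(norm (v (\<gamma> x)))\<^sup>2 * (b - a) > 0" using ab by simp
  with x(3) show ?thesis by simp
qed

end

section \<open>Rectangles in \<open>real ^ 2\<close> and the change of variables\<close>

lemma has_derivative_vec2_coords:
  fixes F :: "real \<times> real \<Rightarrow> 'a::real_normed_vector" and x :: "real ^ 2"
  assumes F: "(F has_derivative F') (at (x $ 1, x $ 2) within I \<times> J)"
    and A: "\<And>y. y \<in> A \<Longrightarrow> y $ 1 \<in> I \<and> y $ 2 \<in> J"
  shows "((\<lambda>y. F (y $ 1, y $ 2)) has_derivative (\<lambda>h. F' (h $ 1, h $ 2))) (at x within A)"
proof -
  have "((\<lambda>y::real ^ 2. (y $ 1, y $ 2)) has_derivative (\<lambda>h. (h $ 1, h $ 2))) (at x within A)"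
    by (intro has_derivative_Pair bounded_linear.has_derivative[OF bounded_linear_vec_nth] has_derivative_ident)
  moreover have "(F has_derivative F') (at (x $ 1, x $ 2) within (\<lambda>y::real ^ 2. (y $ 1, y $ 2)) ` A)"
    by (rule has_derivative_subset[OF F]) (use A in auto)
  ultimately show ?thesis by (rule has_derivative_in_compose)
qed

lemma det_matrix_2:
  fixes a b :: "real ^ 2"
  shows "det (matrix (\<lambda>h :: real ^ 2. h $ 1 *\<^sub>R a + h $ 2 *\<^sub>R b)) = cross2 a b"
  by (simp add: det_2 matrix_def axis_def cross2_def)

lemma mem_cbox_vec2: "z \<in> cbox 0 (vector [a, b]) \<longleftrightarrow> z $ 1 \<in> {0..a} \<and> z $ 2 \<in> {0..b}" for z :: "real ^ 2"
  by (auto simp: mem_box_cart forall_2)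

lemma measure_cbox_vec2:
  assumes "0 \<le> a" "0 \<le> b"
  shows "measure lborel (cbox 0 (vector [a, b]) :: (real ^ 2) set) = a * b"
proof -
  have "(0 :: real ^ 2) \<in> cbox 0 (vector [a, b])" using assms by (simp add: mem_cbox_vec2)
  then show ?thesis by (subst content_cbox_cart) (auto simp: UNIV_2)
qed

text \<open>The left-hand side is the area of the image of the box under the change of variables
  \<open>(s, t) \<mapsto> (\<integral>\<^sub>0\<^sup>s g, t)\<close>.\<close>

lemma integral_first_coordinate:
  fixes g :: "real \<Rightarrow> real"
  assumes g: "continuous_on {0..S} g" "\<And>s. s \<in> {0..S} \<Longrightarrow> 0 < g s" and "0 \<le> S" "0 \<le> T"
  shows "integral (cbox 0 (vector [S, T]) :: (real ^ 2) set) (\<lambda>z. g (z $ 1)) = integral {0..S} g * T"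
proof -
  let ?B = "cbox 0 (vector [S, T]) :: (real ^ 2) set"
  define l where "l = (\<lambda>s. integral {0..s} g)"
  define F where "F = (\<lambda>z :: real ^ 2. (vector [l (z $ 1), z $ 2] :: real ^ 2))"
  have dl: "(l has_real_derivative g s) (at s within {0..S})" if "s \<in> {0..S}" for s
    unfolding l_def by (rule integral_has_real_derivative[OF g(1) that])
  have cl: "continuous_on {0..S} l"
    using dl DERIV_continuous_on by blast
  have mono: "l a < l b" if ab: "0 \<le> a" "a < b" "b \<le> S" for a b
  proof -
    have "\<exists>x\<in>{a<..<b}. l b - l a = g x * (b - a)"
    proof (rule mvt_simple[OF \<open>a < b\<close>])
      fix x assume "a \<le> x" "x \<le> b"
      then have "(l has_real_derivative g x) (at x within {a..b})"
        using ab by (intro DERIV_subset[OF dl]) auto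
      then show "(l has_derivative (*) (g x)) (at x within {a..b})"
        by (simp add: has_field_derivative_def)
    qed
    then obtain x where "a < x" "x < b" "l b - l a = g x * (b - a)" by auto
    then show ?thesis using g(2)[of x] ab by (smt (verit) atLeastAtMost_iff mult_pos_pos)
  qed
  have l0: "l 0 = 0" by (simp add: l_def)
  have l_bounds: "l s \<in> {0..l S}" if "s \<in> {0..S}" for s
    using mono[of 0 s] mono[of s S] that l0 by (cases "s = 0"; cases "s = S") auto
  have inj: "inj_on F ?B"
  proof (rule inj_onI)
    fix x y assume xy: "x \<in> ?B" "y \<in> ?B" "F x = F y"
    then have "l (x $ 1) = l (y $ 1)" "x $ 2 = y $ 2"
      by (auto simp: F_def vec_eq_iff forall_2)
    then show "x = y"
      using mono[of "x $ 1" "y $ 1"] mono[of "y $ 1" "x $ 1"] xy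
      by (auto simp: vec_eq_iff forall_2 mem_cbox_vec2) (metis linorder_neqE_linordered_idom less_irrefl)
  qed
  have dF: "(F has_derivative (\<lambda>h. h $ 1 *\<^sub>R vector [g (z $ 1), 0] + h $ 2 *\<^sub>R vector [0, 1])) (at z within ?B)"
    if z: "z \<in> ?B" for z
  proof -
    have 1: "((\<lambda>z :: real ^ 2. z $ i) has_derivative (\<lambda>h. h $ i)) (at z within ?B)" for i
      by (rule bounded_linear.has_derivative[OF bounded_linear_vec_nth has_derivative_ident])
    have "(l has_derivative (*) (g (z $ 1))) (at (z $ 1) within (\<lambda>z. z $ 1) ` ?B)"
      by (rule has_derivative_subset[OF dl[unfolded has_field_derivative_def]])
        (use z in \<open>auto simp: mem_cbox_vec2\<close>)
    from has_derivative_in_compose[OF 1 this]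
    have 2: "((\<lambda>z. l (z $ 1)) has_derivative (\<lambda>h. g (z $ 1) * h $ 1)) (at z within ?B)" .
    have "F = (\<lambda>z. l (z $ 1) *\<^sub>R axis 1 1 + z $ 2 *\<^sub>R axis 2 1)"
      by (auto simp: F_def vec_eq_iff forall_2 axis_def)
    moreover have "((\<lambda>z. l (z $ 1) *\<^sub>R axis 1 1 + z $ 2 *\<^sub>R axis 2 1) has_derivative
        (\<lambda>h. (g (z $ 1) * h $ 1) *\<^sub>R axis 1 1 + h $ 2 *\<^sub>R (axis 2 1 :: real ^ 2))) (at z within ?B)"
      by (intro has_derivative_add has_derivative_scaleR_left 1 2)
    moreover have "(g (z $ 1) * h $ 1) *\<^sub>R axis 1 1 + h $ 2 *\<^sub>R axis 2 1 =
        h $ 1 *\<^sub>R vector [g (z $ 1), 0] + h $ 2 *\<^sub>R (vector [0, 1] :: real ^ 2)" for h :: "real ^ 2"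
      by (simp add: vec_eq_iff forall_2 axis_def)
    ultimately show ?thesis by simp
  qed
  have image: "F ` ?B = cbox 0 (vector [l S, T])"
  proof (intro equalityI subsetI)
    fix y assume "y \<in> F ` ?B"
    then show "y \<in> cbox 0 (vector [l S, T])"
      using l_bounds by (auto simp: F_def mem_cbox_vec2)
  next
    fix y :: "real ^ 2" assume y: "y \<in> cbox 0 (vector [l S, T])"
    then have "l 0 \<le> y $ 1" "y $ 1 \<le> l S" using l0 by (auto simp: mem_cbox_vec2)
    then obtain s where s: "0 \<le> s" "s \<le> S" "l s = y $ 1"
      using IVT'[of l 0 "y $ 1" S] cl \<open>0 \<le> S\<close> by auto
    have "y = F (vector [s, y $ 2])" using s by (simp add: F_def vec_eq_iff forall_2)
    moreover have "vector [s, y $ 2] \<in> ?B" using s y by (simp add: mem_cbox_vec2)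
    ultimately show "y \<in> F ` ?B" by blast
  qed
  have det: "\<bar>det (matrix (\<lambda>h :: real ^ 2. h $ 1 *\<^sub>R vector [g (z $ 1), 0] + h $ 2 *\<^sub>R vector [0, 1]))\<bar> = g (z $ 1)"
    if "z \<in> ?B" for z
    using g(2)[of "z $ 1"] that by (simp add: det_matrix_2 cross2_def mem_cbox_vec2)
  have "continuous_on ?B (\<lambda>z. g (z $ 1))"
    by (rule continuous_on_compose2[OF g(1)]) (auto simp: mem_cbox_vec2 intro!: continuous_intros)
  then have int: "(\<lambda>z. \<bar>det (matrix (\<lambda>h :: real ^ 2. h $ 1 *\<^sub>R vector [g (z $ 1), 0] + h $ 2 *\<^sub>R vector [0, 1]))\<bar>) integrable_on ?B"
    by (simp only: integrable_cong[OF det] integrable_continuous)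
  have "integral ?B (\<lambda>z. g (z $ 1)) =
      integral ?B (\<lambda>z. \<bar>det (matrix (\<lambda>h :: real ^ 2. h $ 1 *\<^sub>R vector [g (z $ 1), 0] + h $ 2 *\<^sub>R vector [0, 1]))\<bar>)"
    by (intro integral_cong) (simp add: det)
  also have "\<dots> = measure lebesgue (F ` ?B)"
    by (rule measure_differentiable_image_eq[OF _ dF inj int, symmetric]) simp_all
  also have "\<dots> = l S * T"
    unfolding image using measure_cbox_vec2[of "l S" T] l_bounds[of S] \<open>0 \<le> S\<close> \<open>0 \<le> T\<close> by simp
  finally show ?thesis by (simp add: l_def)
qed

text \<open>Of the Jacobian |v(gamma s)|^2 only one factor is replaced by its lower bound
  \<open>m\<close>. The other is kept, so that the integral over s is the length of
  \<open>\<gamma>\<close>, the quantity that the final estimate prescribes.\<close>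

lemma (in divergence_free_field) swept_area:
  assumes lip: "L-lipschitz_on (cball p 1) v" "\<And>x h. x \<in> cball p 1 \<Longrightarrow> norm (D x h) \<le> L * norm h"
    and m: "0 < m" "\<And>x. x \<in> ball p 1 \<Longrightarrow> m \<le> norm (v x)"
    and ST: "0 \<le> S" "0 \<le> T"
    and \<gamma>: "\<And>s. s \<in> {0..S} \<Longrightarrow> (\<gamma> has_vector_derivative perp_field v (\<gamma> s)) (at s within {0..S})"
    and X: "\<And>s. s \<in> {0..S} \<Longrightarrow> X s 0 = \<gamma> s"
      "\<And>s t. s \<in> {0..S} \<Longrightarrow> t \<in> {0..T} \<Longrightarrow> X s t \<in> ball p 1"
      "\<And>s t. s \<in> {0..S} \<Longrightarrow> t \<in> {0..T} \<Longrightarrow> (X s has_vector_derivative v (X s t)) (at t within {0..T})"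
  shows "m * (integral {0..S} (\<lambda>s. norm (v (\<gamma> s))) * T) \<le> pi"
proof -
  let ?B = "cbox 0 (vector [S, T]) :: (real ^ 2) set"
  let ?K = "cball p 1"
  have KU: "ball p 1 \<subseteq> ?K" "?K \<subseteq> U" using ball_subset_cball disc by auto
  have XK: "X s t \<in> ?K" if "s \<in> {0..S}" "t \<in> {0..T}" for s t using X(2)[OF that] KU(1) by blast
  have XU: "X s t \<in> U" if "s \<in> {0..S}" "t \<in> {0..T}" for s t using XK[OF that] KU(2) by blast
  have \<gamma>b: "\<gamma> s \<in> ball p 1" if "s \<in> {0..S}" for s using X(1)[OF that] X(2)[OF that, of 0] ST by simp
  have nz: "v x \<noteq> 0" if "x \<in> ball p 1" for x using m(1) m(2)[OF that] by auto
  have C1: "C1_field U v D" ..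
  have cX: "continuous_on {0..T} (X s)" if "s \<in> {0..S}" for s
    using X(3)[OF that] by (rule continuous_on_vector_derivative)
  \<comment> \<open>The solution \<open>w\<close> will be the derivative of the trajectory in s; it
    starts with the velocity of \<open>\<gamma>\<close> because the trajectories start on that
    curve.\<close>
  have "\<exists>w. w 0 = perp_field v (\<gamma> s) \<and>
      (\<forall>t\<in>{0..T}. (w has_vector_derivative D (X s t) (w t)) (at t within {0..T}))" if s: "s \<in> {0..S}" for s
    by (rule variational_solution_exists[OF C1 KU(2) ST(2) lip cX[OF s] XK[OF s], of "perp_field v (\<gamma> s)"]) blast+
  then obtain w where w: "\<And>s. s \<in> {0..S} \<Longrightarrow> w s 0 = perp_field v (\<gamma> s)"
    "\<And>s t. s \<in> {0..S} \<Longrightarrow> t \<in> {0..T} \<Longrightarrow> (w s has_vector_derivative D (X s t) (w s t)) (at t within {0..T})"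
    by metis
  have init: "((\<lambda>s. X s 0) has_vector_derivative w s 0) (at s within {0..S})" if s: "s \<in> {0..S}" for s
    using has_vector_derivative_transform[OF s X(1) \<gamma>[OF s]] w(1)[OF s] by simp
  define F where "F = (\<lambda>z :: real ^ 2. X (z $ 1) (z $ 2))"
  define F' where "F' = (\<lambda>(z :: real ^ 2) (h :: real ^ 2). h $ 1 *\<^sub>R w (z $ 1) (z $ 2) + h $ 2 *\<^sub>R v (F z))"
  have dF: "(F has_derivative F' z) (at z within ?B)" if z: "z \<in> ?B" for z
  proof -
    have z': "z $ 1 \<in> {0..S}" "z $ 2 \<in> {0..T}" using z by (auto simp: mem_cbox_vec2)
    have "((\<lambda>y. X (fst y) (snd y)) has_derivative
        (\<lambda>h. fst h *\<^sub>R w (z $ 1) (z $ 2) + snd h *\<^sub>R v (X (z $ 1) (z $ 2))))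
        (at (z $ 1, z $ 2) within {0..S} \<times> {0..T})"
      by (rule solution_jointly_differentiable[OF C1 compact_cball convex_cball KU(2) lip XK X(3)
            init[OF z'(1)] z'(1) w(2)[OF z'(1)] z'(2)])
    \<comment> \<open>Pairs are traded for \<open>real ^ 2\<close>, where the determinant and the
      change of variables live.\<close>
    from has_derivative_vec2_coords[OF this, of ?B]
    show ?thesis by (simp add: F_def F'_def mem_cbox_vec2)
  qed
  have det: "\<bar>det (matrix (F' z))\<bar> = (norm (v (\<gamma> (z $ 1))))\<^sup>2" if z: "z \<in> ?B" for z
  proof -
    have z': "z $ 1 \<in> {0..S}" "z $ 2 \<in> {0..T}" using z by (auto simp: mem_cbox_vec2)
    have "det (matrix (F' z)) = cross2 (w (z $ 1) (z $ 2)) (v (X (z $ 1) (z $ 2)))"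
      by (simp add: F'_def F_def det_matrix_2)
    also have "\<dots> = cross2 (w (z $ 1) 0) (v (X (z $ 1) 0))"
      by (rule cross2_variational_constant[OF XU[OF z'(1)] X(3)[OF z'(1)] w(2)[OF z'(1)] z'(2)])
    also have "\<dots> = cross2 (perp_field v (\<gamma> (z $ 1))) (v (\<gamma> (z $ 1)))"
      using w(1)[OF z'(1)] X(1)[OF z'(1)] by simp
    also have "\<dots> = - cross2 (v (\<gamma> (z $ 1))) (perp_field v (\<gamma> (z $ 1)))" by (simp add: cross2_def)
    finally show ?thesis by (simp add: cross2_perp)
  qed
  have inj: "inj_on F ?B"
  proof (rule inj_onI)
    fix x y assume xy: "x \<in> ?B" "y \<in> ?B" "F x = F y"
    then have x: "x $ 1 \<in> {0..S}" "x $ 2 \<in> {0..T}" and y: "y $ 1 \<in> {0..S}" "y $ 2 \<in> {0..T}"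
      by (auto simp: mem_cbox_vec2)
    have F\<gamma>: "stream (F z) = stream (\<gamma> (z $ 1))" if "z $ 1 \<in> {0..S}" "z $ 2 \<in> {0..T}" for z
      unfolding F_def using stream_of_solution[OF X(2)[OF that(1)] X(3)[OF that(1)] that(2)] X(1)[OF that(1)] by simp
    have "stream (\<gamma> (x $ 1)) = stream (\<gamma> (y $ 1))"
      unfolding F\<gamma>[OF x, symmetric] F\<gamma>[OF y, symmetric] xy(3) ..
    then have 1: "x $ 1 = y $ 1"
      using stream_strict_mono_perp[OF \<gamma>b \<gamma> nz, of "x $ 1" "y $ 1"]
        stream_strict_mono_perp[OF \<gamma>b \<gamma> nz, of "y $ 1" "x $ 1"] x y
      by (cases "x $ 1" "y $ 1" rule: linorder_cases) auto
    have "X (x $ 1) (x $ 2) = X (x $ 1) (y $ 2)"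
      using xy(3) 1 by (simp add: F_def)
    from inj_onD[OF solution_inj[OF X(2)[OF x(1)] X(3)[OF x(1)] m] this x(2) y(2)] 1
    show "x = y" by (simp add: vec_eq_iff forall_2)
  qed
  have c\<gamma>: "continuous_on {0..S} \<gamma>" using \<gamma> by (rule continuous_on_vector_derivative)
  have cv\<gamma>: "continuous_on {0..S} (\<lambda>s. norm (v (\<gamma> s)))"
    by (intro continuous_intros continuous_on_compose2[OF continuous_on_f c\<gamma>]) (use \<gamma>b ball_subset_U in blast)
  have cB: "continuous_on ?B (\<lambda>z. norm (v (\<gamma> (z $ 1))))"
    by (rule continuous_on_compose2[OF cv\<gamma>]) (auto simp: mem_cbox_vec2 intro!: continuous_intros)
  have int2: "(\<lambda>z. (norm (v (\<gamma> (z $ 1))))\<^sup>2) integrable_on ?B"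
    by (intro integrable_continuous continuous_intros cB)
  have int: "(\<lambda>z. \<bar>det (matrix (F' z))\<bar>) integrable_on ?B"
    using int2 by (simp only: integrable_cong[OF det])
  have "m * (integral {0..S} (\<lambda>s. norm (v (\<gamma> s))) * T) = m * integral ?B (\<lambda>z. norm (v (\<gamma> (z $ 1))))"
    by (subst integral_first_coordinate[OF cv\<gamma> _ ST]) (use nz \<gamma>b in auto)
  also have "\<dots> = integral ?B (\<lambda>z. m * norm (v (\<gamma> (z $ 1))))"
    by simp
  also have "\<dots> \<le> integral ?B (\<lambda>z. (norm (v (\<gamma> (z $ 1))))\<^sup>2)"
  proof (rule integral_le)
    show "(\<lambda>z. m * norm (v (\<gamma> (z $ 1)))) integrable_on ?B"
      by (intro integrable_continuous continuous_intros cB)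
    show "(\<lambda>z. (norm (v (\<gamma> (z $ 1))))\<^sup>2) integrable_on ?B" by (rule int2)
    fix z assume "z \<in> ?B"
    then have "m \<le> norm (v (\<gamma> (z $ 1)))" using m(2) \<gamma>b by (auto simp: mem_cbox_vec2)
    then show "m * norm (v (\<gamma> (z $ 1))) \<le> (norm (v (\<gamma> (z $ 1))))\<^sup>2"
      by (simp add: power2_eq_square mult_right_mono)
  qed
  also have "\<dots> = integral ?B (\<lambda>z. \<bar>det (matrix (F' z))\<bar>)"
    by (intro integral_cong) (simp add: det)
  also have "\<dots> = measure lebesgue (F ` ?B)"
    by (rule measure_differentiable_image_eq[OF _ dF inj int, symmetric]) simp_all
  also have "\<dots> \<le> measure lebesgue (ball p 1)"
  proof (rule measure_mono_fmeasurable)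
    show "F ` ?B \<subseteq> ball p 1" using X(2) by (auto simp: F_def mem_cbox_vec2)
    have "compact (F ` ?B)"
      using dF by (intro compact_continuous_image compact_cbox has_derivative_continuous_on) auto
    then show "F ` ?B \<in> sets lebesgue" by (simp add: borel_compact)
  qed simp
  also have "\<dots> = pi" using circle_area[of 1 p] by simp
  finally show ?thesis .
qed

section \<open>Reaching the unit circle within the length bound\<close>

lemma lipschitz_on_perp_field:
  assumes "L-lipschitz_on S v"
  shows "L-lipschitz_on S (perp_field v)"
proof (rule lipschitz_onI)
  fix x y assume xy: "x \<in> S" "y \<in> S"
  have "perp_field v x - perp_field v y = perp_field (\<lambda>_. v x - v y) x"
    by (simp add: perp_field_def vec_eq_iff forall_2)
  then have "dist (perp_field v x) (perp_field v y) = dist (v x) (v y)"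
    by (simp add: dist_norm)
  then show "dist (perp_field v x) (perp_field v y) \<le> L * dist x y"
    using lipschitz_onD[OF assms xy] by simp
qed (rule lipschitz_on_nonneg[OF assms])

theorem theorem1:
  fixes c1 c2 :: real
    and p :: "real ^ 2"
    and v :: "real ^ 2 \<Rightarrow> real ^ 2"
    and U :: "(real ^ 2) set"
  assumes "0 < c1" and "c1 < c2"
    and "open U" and "cball p 1 \<subseteq> U"
    and "smooth_on U v"
    and "incompressible_on U v"
    and "\<And>x. x \<in> U \<Longrightarrow> c1 < norm (v x) \<and> norm (v x) < c2"
  shows "\<exists>s t. 0 \<le> s \<and> 0 \<le> t \<and>
           flow_exists U (perp_field v) s p \<and>
           flow_exists U v t (flow U (perp_field v) s p) \<and>
           norm (flow U v t (flow U (perp_field v) s p) - p) = 1 \<and>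
           two_flow_length U v t (perp_field v) s p \<le> sqrt (4 * pi) * sqrt (c2 / c1)"
proof -
  define D where "D = (\<lambda>x. frechet_derivative v (at x))"
  interpret C1_field U v D
    unfolding D_def by (rule smooth_on_imp_C1_field[OF assms(5)])
  interpret divergence_free_field U v D p
  proof
    show "cball p 1 \<subseteq> U" by fact
    show "D x (axis 1 1) $ 1 + D x (axis 2 1) $ 2 = 0" if "x \<in> U" for x
      using assms(6) that by (simp add: incompressible_on_def flip: partial_deriv_eq[OF der[OF that]])
  qed
  obtain r where r: "1 < r" "cball p r \<subseteq> U"
    using cball_enlarge[OF assms(3,4)] by auto
  obtain L where L: "L-lipschitz_on (cball p r) v" "\<And>x h. x \<in> cball p r \<Longrightarrow> norm (D x h) \<le> L * norm h"
    using lipschitz[OF compact_cball r(2) convex_cball] by blast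
  have sub: "cball p 1 \<subseteq> cball p r" using r(1) by auto
  note L1 = lipschitz_on_subset[OF L(1) sub]
  note Lp = lipschitz_on_perp_field[OF L(1)] and Lp1 = lipschitz_on_perp_field[OF L1]
  have cv: "continuous_on (cball p 1) (\<lambda>x. norm (v x))"
    by (intro continuous_intros continuous_on_subset[OF continuous_on_f assms(4)])
  \<comment> \<open>The minimum of |v| over the compact disc is strictly above \<open>c1\<close>;
    the bare bound \<open>c1\<close> would give only pi \<le> pi at the end.\<close>
  obtain x0 where x0: "x0 \<in> cball p 1" "\<And>x. x \<in> cball p 1 \<Longrightarrow> norm (v x0) \<le> norm (v x)"
    using continuous_attains_inf[OF compact_cball _ cv] by auto
  have m: "c1 < norm (v x0)" using assms(4,7) x0(1) by blast
  define A where "A = sqrt (pi * c2 / c1)"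
  have A: "0 < A" "A * A = pi * c2 / c1" and c2: "0 < c2"
    using assms(1,2) by (auto simp: A_def simp flip: real_sqrt_mult)
  have bound: "sqrt (4 * pi) * sqrt (c2 / c1) = A + A"
    by (simp add: A_def real_sqrt_mult real_sqrt_divide)
  let ?P = "closest_point (cball p 1)"
  have P: "?P x \<in> cball p 1" for x by (rule closest_point_in_set) auto
  have P_id: "?P x = x" if "x \<in> cball p 1" for x using that by (rule closest_point_self)
  have vP: "c1 \<le> norm (v (?P x))" "norm (v (?P x)) \<le> c2" for x
    using assms(7)[of "?P x"] P[of x] assms(4) by (auto intro: less_imp_le)
  \<comment> \<open>The projected field has speed at least \<open>c1\<close> everywhere, so by time
    \<open>A / c1\<close> its trajectory has length at least \<open>A\<close>.\<close>
  obtain \<gamma> where \<gamma>: "\<gamma> 0 = p" "\<And>t. t \<in> {0..A / c1} \<Longrightarrow>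
      (\<gamma> has_vector_derivative perp_field v (?P (\<gamma> t))) (at t within {0..A / c1})"
    using projected_solution_exists[OF Lp1, of "A / c1" p] A(1) assms(1) by auto
  define g where "g = (\<lambda>u. norm (v (?P (\<gamma> u))))"
  define l where "l = (\<lambda>s. integral {0..s} g)"
  have c\<gamma>: "continuous_on {0..A / c1} \<gamma>" using \<gamma>(2) by (rule continuous_on_vector_derivative)
  have "continuous_on UNIV ?P" by (rule continuous_on_closest_point) auto
  then have "continuous_on {0..A / c1} (\<lambda>u. ?P (\<gamma> u))"
    by (rule continuous_on_compose2[OF _ c\<gamma>]) auto
  then have cg: "continuous_on {0..A / c1} g"
    unfolding g_def by (rule continuous_on_compose2[OF cv]) (use P in auto)
  have ig: "g integrable_on {a..b}" if "0 \<le> a" "b \<le> A / c1" for a b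
    by (rule integrable_continuous_real[OF continuous_on_subset[OF cg]]) (use that in auto)
  have "integral {0..A / c1} (\<lambda>u. c1) \<le> l (A / c1)"
    unfolding l_def by (intro integral_le ig) (use vP in \<open>auto simp: g_def\<close>)
  then have "A \<le> l (A / c1)" using assms(1) A(1) by simp
  moreover have "continuous_on {0..A / c1} l"
    unfolding l_def by (rule indefinite_integral_continuous_1[OF ig]) auto
  \<comment> \<open>At time \<open>S\<close> the trajectory of the projected field has length
    exactly \<open>A\<close>; as long as it stays in the disc, this is the length along
    \<open>perp_field v\<close>.\<close>
  ultimately obtain S where S: "0 \<le> S" "S \<le> A / c1" "l S = A"
    using IVT'[of l 0 A "A / c1"] A(1) assms(1) by (auto simp: l_def)
  have \<gamma>': "(\<gamma> has_vector_derivative perp_field v (?P (\<gamma> u))) (at u within {0..s})"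
    if "s \<in> {0..S}" "u \<in> {0..s}" for s u
    by (rule has_vector_derivative_within_subset[OF \<gamma>(2)]) (use that S in auto)
  have l_le: "l s \<le> A" if "s \<in> {0..S}" for s
    unfolding S(3)[symmetric] l_def
    by (rule integral_subset_le) (use that S ig in \<open>auto simp: g_def\<close>)
  \<comment> \<open>Both ways of reaching the circle are concluded here. The curves stay in the
    closed disc, where the projection is the identity; the first has length at most
    \<open>l S = A\<close>, and the second at most \<open>c2\<close> times
    \<open>A / c2\<close>.\<close>
  have arrived: ?thesis
    if s: "s \<in> {0..S}" "\<And>u. u \<in> {0..s} \<Longrightarrow> \<gamma> u \<in> cball p 1"
      and t: "0 \<le> t" "t \<le> A / c2" "\<And>u. u \<in> {0..t} \<Longrightarrow> X u \<in> cball p 1"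
      and X: "X 0 = \<gamma> s" "\<And>u. u \<in> {0..t} \<Longrightarrow> (X has_vector_derivative v (X u)) (at u within {0..t})"
      and exit: "dist p (X t) = 1" for s t X
  proof -
    have d\<gamma>: "(\<gamma> has_vector_derivative perp_field v (\<gamma> u)) (at u within {0..s})" if "u \<in> {0..s}" for u
      using \<gamma>'[OF s(1) that] P_id[OF s(2)[OF that]] by simp
    have s0: "0 \<le> s" using s(1) by simp
    have f1: "flow_exists U (perp_field v) s p" "flow U (perp_field v) s p = \<gamma> s"
      "flow_length U (perp_field v) s p = integral {0..s} (\<lambda>u. norm (perp_field v (\<gamma> u)))"
      using flow_of_solution[where X = \<gamma>, OF Lp r(1) assms(4) s0 s(2) d\<gamma>] \<gamma>(1) by simp_all
    have f2: "flow_exists U v t (\<gamma> s)" "flow U v t (\<gamma> s) = X t"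
      "flow_length U v t (\<gamma> s) = integral {0..t} (\<lambda>u. norm (v (X u)))"
      using flow_of_solution[where X = X, OF L(1) r(1) assms(4) t(1) t(3) X(2)] X(1) by simp_all
    have "integral {0..s} (\<lambda>u. norm (perp_field v (\<gamma> u))) = l s"
      unfolding l_def by (rule integral_cong) (simp only: g_def norm_perp_field P_id[OF s(2)])
    then have "flow_length U (perp_field v) s p \<le> A" using f1(3) l_le[OF s(1)] by simp
    moreover have "integral {0..t} (\<lambda>u. norm (v (X u))) \<le> integral {0..t} (\<lambda>u. c2)"
    proof (rule integral_le)
      have "continuous_on {0..t} X" using X(2) by (rule continuous_on_vector_derivative)
      then show "(\<lambda>u. norm (v (X u))) integrable_on {0..t}"
        by (intro integrable_continuous_real continuous_on_compose2[OF cv]) (use t(3) in auto)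
      show "norm (v (X u)) \<le> c2" if "u \<in> {0..t}" for u
        using vP(2)[of "X u"] P_id[OF t(3)[OF that]] by simp
    qed (rule integrable_const_ivl)
    then have "flow_length U v t (\<gamma> s) \<le> A"
      using f2(3) t(1,2) c2 by (simp add: field_simps)
    ultimately have "two_flow_length U v t (perp_field v) s p \<le> A + A"
      unfolding two_flow_length_def f1(2) by simp
    then show ?thesis
      using s0 t(1) f1(1,2) f2(1,2) exit bound
      by (intro exI[of _ s] exI[of _ t]) (simp add: dist_norm norm_minus_commute)
  qed
  show ?thesis
  proof (cases "\<exists>s\<in>{0..S}. 1 \<le> dist p (\<gamma> s)")
    case True
    then obtain s where s: "s \<in> {0..S}" "1 \<le> dist p (\<gamma> s)" by blast
    have "continuous_on {0..S} (\<lambda>u. dist p (\<gamma> u))"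
      using S by (intro continuous_intros continuous_on_subset[OF c\<gamma>]) auto
    from first_hitting_time[OF this _ s] \<gamma>(1)
    obtain \<tau> where \<tau>: "\<tau> \<in> {0..S}" "dist p (\<gamma> \<tau>) = 1" "\<And>u. u \<in> {0..\<tau>} \<Longrightarrow> dist p (\<gamma> u) \<le> 1"
      by auto
    \<comment> \<open>The first stretch already reaches the circle, so \<open>t = 0\<close> and the
      second curve matters only at time 0; a straight line with the right initial velocity
      serves.\<close>
    show ?thesis
    proof (rule arrived[OF \<tau>(1), of 0 "\<lambda>u. \<gamma> \<tau> + u *\<^sub>R v (\<gamma> \<tau>)"])
      show "((\<lambda>u. \<gamma> \<tau> + u *\<^sub>R v (\<gamma> \<tau>)) has_vector_derivative v (\<gamma> \<tau> + u *\<^sub>R v (\<gamma> \<tau>))) (at u within {0..0})"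
        if "u \<in> {0..0}" for u :: real
        using that by (auto intro!: derivative_eq_intros)
    qed (use \<tau> A(1) c2 in auto)
  next
    case False
    then have \<gamma>b: "\<gamma> s \<in> ball p 1" if "s \<in> {0..S}" for s using that by force
    then have \<gamma>c: "\<gamma> s \<in> cball p 1" if "s \<in> {0..S}" for s using that ball_subset_cball by blast
    define T where "T = A / c2"
    have T: "0 \<le> T" using A(1) c2 by (simp add: T_def)
    have "\<exists>X. X 0 = \<gamma> s \<and> (\<forall>t\<in>{0..T}. (X has_vector_derivative v (?P (X t))) (at t within {0..T}))" for s
      by (rule projected_solution_exists[OF L1 zero_le_one T, of "\<gamma> s"]) blast
    then obtain X where X: "\<And>s. X s 0 = \<gamma> s"
      "\<And>s t. t \<in> {0..T} \<Longrightarrow> (X s has_vector_derivative v (?P (X s t))) (at t within {0..T})"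
      by metis
    show ?thesis
    proof (cases "\<exists>s\<in>{0..S}. \<exists>t\<in>{0..T}. 1 \<le> dist p (X s t)")
      case True
      then obtain s t where st: "s \<in> {0..S}" "t \<in> {0..T}" "1 \<le> dist p (X s t)" by blast
      have "continuous_on {0..T} (\<lambda>u. dist p (X s u))"
        using X(2) by (intro continuous_intros) (rule continuous_on_vector_derivative)
      from first_hitting_time[OF this _ st(2,3)] X(1)[of s] \<gamma>c[OF st(1)]
      obtain \<tau> where \<tau>: "\<tau> \<in> {0..T}" "dist p (X s \<tau>) = 1" "\<And>u. u \<in> {0..\<tau>} \<Longrightarrow> dist p (X s u) \<le> 1"
        by auto
      show ?thesis
      proof (rule arrived[OF st(1), of \<tau> "X s"])
        fix u assume u: "u \<in> {0..\<tau>}"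
        show "X s u \<in> cball p 1" using \<tau>(3)[OF u] by simp
        then show "(X s has_vector_derivative v (X s u)) (at u within {0..\<tau>})"
          using has_vector_derivative_within_subset[OF X(2), of u "{0..\<tau>}" s] u \<tau>(1) P_id by auto
      qed (use st \<gamma>c \<tau> X(1) in \<open>auto simp: T_def\<close>)
    next
      case False
      then have Xb: "X s t \<in> ball p 1" if "s \<in> {0..S}" "t \<in> {0..T}" for s t using that by force
      then have Xc: "?P (X s t) = X s t" if "s \<in> {0..S}" "t \<in> {0..T}" for s t
        using that P_id ball_subset_cball by blast
      \<comment> \<open>No trajectory reaches the circle, so the whole rectangle is mapped into the
        open disc. Length \<open>A\<close> times time \<open>A / c2\<close> is pi / c1, and the
        factor \<open>norm (v x0)\<close> lifts the area bound above pi.\<close>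
      have "norm (v x0) * (integral {0..S} (\<lambda>s. norm (v (\<gamma> s))) * T) \<le> pi"
      proof (rule swept_area[OF L1 _ _ _ S(1) T, where X = X])
        show "norm (D x h) \<le> L * norm h" if "x \<in> cball p 1" for x h
          using L(2) sub that by blast
        show "(\<gamma> has_vector_derivative perp_field v (\<gamma> s)) (at s within {0..S})" if "s \<in> {0..S}" for s
          using \<gamma>'[of S s] that S(1) P_id[OF \<gamma>c[OF that]] by simp
        show "(X s has_vector_derivative v (X s t)) (at t within {0..T})"
          if "s \<in> {0..S}" "t \<in> {0..T}" for s t
          using X(2)[OF that(2), of s] Xc[OF that] by simp
        show "0 < norm (v x0)" using m assms(1) by linarith
        show "norm (v x0) \<le> norm (v x)" if "x \<in> ball p 1" for x
          using x0(2) that ball_subset_cball by blast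
      qed (use X(1) Xb in auto)
      also have "integral {0..S} (\<lambda>s. norm (v (\<gamma> s))) = l S"
        unfolding l_def by (rule integral_cong) (simp only: g_def P_id[OF \<gamma>c])
      also have "l S * T = pi / c1"
        using A c2 by (simp add: S(3) T_def)
      finally have "norm (v x0) * (pi / c1) \<le> pi" .
      moreover have "c1 * (pi / c1) < norm (v x0) * (pi / c1)"
        using m assms(1) by (intro mult_strict_right_mono) auto
      ultimately show ?thesis using assms(1) by simp
    qed
  qed
qed

end
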